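(* Let $e\ge1$, let $D_{2e}=C_e\rtimes S_2=\langle\rho,\sigma\rangle$ act on $B=\mathbb C[x_1,x_2]$ by $\rho(x_1)=\epsilon x_1$, $\rho(x_2)=\epsilon^{-1}x_2$, $\epsilon=\exp(2\pi i/e)$, $\sigma$ interchanging $x_1,x_2$, and put $\mathcal D_1=\mathcal D_B^{C_e}$, $\mathcal D_2=\mathcal D_B^{D_{2e}}$, $J=J_{C_e}^{D_{2e}}$. (1) $J(N_i)=M_i^1$ for $0\le i<e/2$, and $J(N_i)=M_{e-i}^2$ for $e/2<i<e$. (2) If $e=2e_1$ is even, $J(N_{e_1})=M_{e_1}^I\oplus M_{e_1}^{II}$. (3) The simple $\mathcal D_2$-submodules of $B$ are either isomorphic to the image under MLS-restriction $J$ of a simple $\mathcal D_1$-submodule of $B$, or are modules of semi-invariants belonging to a linear character of $D_{2e}$. The latter case occurs for $M_{e_1}^I$, $M_{e_1}^{II}$ ($e=2e_1$ even) and $M_e$ (all $e$).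
   Context: $\mathcal D_B$ is the Weyl algebra on $B$, graded by $\deg x_i=1$, $\deg\partial_i=-1$, with the induced group action; $\mathcal D_i^-$ is the sum of the parts of $\mathcal D_i$ of strictly negative degree. MLS-restriction: for a $\mathcal D_1$-submodule $N\subset B$, $J(N)=\mathcal D_2\cdot\{y\in N:\mathcal D_1^-y=0\}$. $A_1=B^{C_e}=\mathbb C[x_1^e,x_2^e,x_1x_2]$ and $A_2=B^{D_{2e}}=\mathbb C[x_1^e+x_2^e,x_1x_2]$. The $\mathcal D_1$-modules $N_i=A_1x_1^i+A_1x_2^{e-i}$, $0\le i\le e-1$, are simple and $B=\bigoplus_{i=0}^{e-1}N_i$. The $\mathcal D_2$-submodules of $B$ are: $M_0=M_0^1=A_2$; $M_e=\mathcal D_2(x_1^e-x_2^e)=A_2(x_1^e-x_2^e)$; for $1\le i<e/2$, $M_i^1=\mathcal D_2x_1^i=A_2x_1^i+A_2x_2^{e-i}$ and $M_i^2=\mathcal D_2x_2^i=A_2x_2^i+A_2x_1^{e-i}$; and for $e=2e_1$ even, $M_{e_1}^I=A_2(x_1^{e_1}+x_2^{e_1})$, $M_{e_1}^{II}=A_2(x_1^{e_1}-x_2^{e_1})$. The module of semi-invariants of a linear character $\phi:D_{2e}\to\mathbb C^*$ is the $\phi$-isotypic component of $B$. *)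

theory Defs
  imports
    Complex_Main
    "HOL-Library.Poly_Mapping"
    "HOL-Library.Product_Plus"
    "HOL-Algebra.Bij"
    "HOL-Algebra.Generated_Groups"
begin

text \<open>
  \<open>B = \<complex>[x\<^sub>1, x\<^sub>2]\<close> is the monoid algebra of \<open>\<nat> \<times> \<nat>\<close>: the key \<open>(a, b)\<close> stands for the
  monomial \<open>x\<^sub>1\<^sup>a x\<^sub>2\<^sup>b\<close>.
\<close>

type_synonym poly2 = "(nat \<times> nat) \<Rightarrow>\<^sub>0 complex"

definition x1 :: poly2 where "x1 = Poly_Mapping.single (1, 0) 1"

definition x2 :: poly2 where "x2 = Poly_Mapping.single (0, 1) 1"

definition const :: "complex \<Rightarrow> poly2" where "const c = Poly_Mapping.single 0 c"

definition subst2 :: "poly2 \<Rightarrow> poly2 \<Rightarrow> poly2 \<Rightarrow> poly2" where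
  "subst2 p q f =
     (\<Sum>(a, b) \<in> Poly_Mapping.keys f. const (Poly_Mapping.lookup f (a, b)) * p ^ a * q ^ b)"

text \<open>In the derivatives the truncated exponents only occur with coefficient \<open>0\<close>.\<close>

definition d1 :: "poly2 \<Rightarrow> poly2" where
  "d1 f = (\<Sum>(a, b) \<in> Poly_Mapping.keys f.
     Poly_Mapping.single (a - 1, b) (of_nat a * Poly_Mapping.lookup f (a, b)))"

definition d2 :: "poly2 \<Rightarrow> poly2" where
  "d2 f = (\<Sum>(a, b) \<in> Poly_Mapping.keys f.
     Poly_Mapping.single (a, b - 1) (of_nat b * Poly_Mapping.lookup f (a, b)))"


section \<open>The group action\<close>

definition eps :: "nat \<Rightarrow> complex" where
  "eps e = exp (2 * of_real pi * \<i> / of_nat e)"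

definition rho :: "nat \<Rightarrow> poly2 \<Rightarrow> poly2" where
  "rho e = subst2 (const (eps e) * x1) (const (inverse (eps e)) * x2)"

definition sigma :: "poly2 \<Rightarrow> poly2" where
  "sigma = subst2 x2 x1"

text \<open>
  The action of the dihedral group on \<open>B\<close> is faithful for \<open>e \<ge> 1\<close>, so the groups are taken
  as groups of bijections of \<open>B\<close>.
\<close>

definition cyc :: "nat \<Rightarrow> (poly2 \<Rightarrow> poly2) set" where
  "cyc e = generate (BijGroup UNIV) {rho e}"

definition dih :: "nat \<Rightarrow> (poly2 \<Rightarrow> poly2) set" where
  "dih e = generate (BijGroup UNIV) {rho e, sigma}"

definition invariants :: "(poly2 \<Rightarrow> poly2) set \<Rightarrow> poly2 set" where
  "invariants G = {f. \<forall>g\<in>G. g f = f}"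

definition linear_char :: "nat \<Rightarrow> ((poly2 \<Rightarrow> poly2) \<Rightarrow> complex) \<Rightarrow> bool" where
  "linear_char e \<phi> \<longleftrightarrow>
     (\<forall>g\<in>dih e. \<phi> g \<noteq> 0) \<and> (\<forall>g\<in>dih e. \<forall>h\<in>dih e. \<phi> (g \<circ> h) = \<phi> g * \<phi> h)"

text \<open>For a one-dimensional representation the isotypic component is the common eigenspace.\<close>

definition semi_invariants :: "nat \<Rightarrow> ((poly2 \<Rightarrow> poly2) \<Rightarrow> complex) \<Rightarrow> poly2 set" where
  "semi_invariants e \<phi> = {f. \<forall>g\<in>dih e. g f = const (\<phi> g) * f}"


section \<open>The Weyl algebra\<close>

text \<open>
  In characteristic \<open>0\<close> the Weyl algebra acts faithfully on \<open>B\<close>, so it is taken as the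
  algebra of operators on \<open>B\<close> generated by \<open>x\<^sub>1, x\<^sub>2, \<partial>\<^sub>1, \<partial>\<^sub>2\<close>.
\<close>

inductive_set weyl :: "(poly2 \<Rightarrow> poly2) set" where
  "(\<lambda>f. const c * f) \<in> weyl"
| "(\<lambda>f. x1 * f) \<in> weyl"
| "(\<lambda>f. x2 * f) \<in> weyl"
| "d1 \<in> weyl"
| "d2 \<in> weyl"
| "P \<in> weyl \<Longrightarrow> Q \<in> weyl \<Longrightarrow> (\<lambda>f. P f + Q f) \<in> weyl"
| "P \<in> weyl \<Longrightarrow> Q \<in> weyl \<Longrightarrow> P \<circ> Q \<in> weyl"

text \<open>\<open>weyl_part d\<close> is the homogeneous part of degree \<open>d\<close>.\<close>

inductive weyl_part :: "int \<Rightarrow> (poly2 \<Rightarrow> poly2) \<Rightarrow> bool" where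
  "weyl_part 0 (\<lambda>f. const c * f)"
| "weyl_part 1 (\<lambda>f. x1 * f)"
| "weyl_part 1 (\<lambda>f. x2 * f)"
| "weyl_part (-1) d1"
| "weyl_part (-1) d2"
| "weyl_part d P \<Longrightarrow> weyl_part d Q \<Longrightarrow> weyl_part d (\<lambda>f. P f + Q f)"
| "weyl_part d P \<Longrightarrow> weyl_part d' Q \<Longrightarrow> weyl_part (d + d') (P \<circ> Q)"

text \<open>The induced action of \<open>g\<close> on operators is \<open>P \<mapsto> g P g\<^sup>-\<^sup>1\<close>.\<close>

definition weyl_inv :: "(poly2 \<Rightarrow> poly2) set \<Rightarrow> (poly2 \<Rightarrow> poly2) set" where
  "weyl_inv G = {P \<in> weyl. \<forall>g\<in>G. g \<circ> P \<circ> inv_into UNIV g = P}"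

definition D1 :: "nat \<Rightarrow> (poly2 \<Rightarrow> poly2) set" where "D1 e = weyl_inv (cyc e)"

definition D2 :: "nat \<Rightarrow> (poly2 \<Rightarrow> poly2) set" where "D2 e = weyl_inv (dih e)"

definition neg_part :: "(poly2 \<Rightarrow> poly2) set \<Rightarrow> (poly2 \<Rightarrow> poly2) set" where
  "neg_part D = {(\<lambda>f. \<Sum>d\<in>{1..n}. Q d f) | (n :: nat) Q.
     \<forall>d\<in>{1..n}. Q d \<in> D \<and> weyl_part (- int d) (Q d)}"


section \<open>Modules\<close>

definition submod :: "(poly2 \<Rightarrow> poly2) set \<Rightarrow> poly2 set \<Rightarrow> bool" where
  "submod D M \<longleftrightarrow>
     0 \<in> M \<and> (\<forall>f\<in>M. \<forall>g\<in>M. f + g \<in> M) \<and> (\<forall>P\<in>D. \<forall>f\<in>M. P f \<in> M)"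

definition simple_submod :: "(poly2 \<Rightarrow> poly2) set \<Rightarrow> poly2 set \<Rightarrow> bool" where
  "simple_submod D M \<longleftrightarrow>
     submod D M \<and> M \<noteq> {0} \<and> (\<forall>M'. submod D M' \<and> M' \<subseteq> M \<longrightarrow> M' = {0} \<or> M' = M)"

definition mod_iso :: "(poly2 \<Rightarrow> poly2) set \<Rightarrow> poly2 set \<Rightarrow> poly2 set \<Rightarrow> bool" where
  "mod_iso D M M' \<longleftrightarrow>
     (\<exists>\<theta>. bij_betw \<theta> M M' \<and> (\<forall>f\<in>M. \<forall>g\<in>M. \<theta> (f + g) = \<theta> f + \<theta> g) \<and>
          (\<forall>P\<in>D. \<forall>f\<in>M. \<theta> (P f) = P (\<theta> f)))"

definition is_direct_sum :: "poly2 set \<Rightarrow> poly2 set \<Rightarrow> poly2 set \<Rightarrow> bool" where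
  "is_direct_sum M U V \<longleftrightarrow> M = {u + v | u v. u \<in> U \<and> v \<in> V} \<and> U \<inter> V = {0}"

definition mod_gen :: "(poly2 \<Rightarrow> poly2) set \<Rightarrow> poly2 set \<Rightarrow> poly2 set" where
  "mod_gen D S = {(\<Sum>j<n. P j (y j)) | (n :: nat) P y. \<forall>j<n. P j \<in> D \<and> y j \<in> S}"

definition J :: "nat \<Rightarrow> poly2 set \<Rightarrow> poly2 set" where
  "J e N = mod_gen (D2 e) {y \<in> N. \<forall>P \<in> neg_part (D1 e). P y = 0}"

definition A1 :: "nat \<Rightarrow> poly2 set" where "A1 e = invariants (cyc e)"

definition A2 :: "nat \<Rightarrow> poly2 set" where "A2 e = invariants (dih e)"

definition N :: "nat \<Rightarrow> nat \<Rightarrow> poly2 set" where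
  "N e i = {a * x1 ^ i + b * x2 ^ (e - i) | a b. a \<in> A1 e \<and> b \<in> A1 e}"

text \<open>
  \<open>M1 e 0\<close> is \<open>M\<^sub>0\<^sup>1 = A\<^sub>2\<close>; the general formula would give \<open>A\<^sub>2 + A\<^sub>2 x\<^sub>2\<^sup>e\<close> for \<open>i = 0\<close>.
\<close>

definition M1 :: "nat \<Rightarrow> nat \<Rightarrow> poly2 set" where
  "M1 e i = (if i = 0 then A2 e
             else {a * x1 ^ i + b * x2 ^ (e - i) | a b. a \<in> A2 e \<and> b \<in> A2 e})"

definition M2 :: "nat \<Rightarrow> nat \<Rightarrow> poly2 set" where
  "M2 e i = {a * x2 ^ i + b * x1 ^ (e - i) | a b. a \<in> A2 e \<and> b \<in> A2 e}"

definition Me :: "nat \<Rightarrow> poly2 set" where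
  "Me e = {a * (x1 ^ e - x2 ^ e) | a. a \<in> A2 e}"

definition MI :: "nat \<Rightarrow> nat \<Rightarrow> poly2 set" where
  "MI e i = {a * (x1 ^ i + x2 ^ i) | a. a \<in> A2 e}"

definition MII :: "nat \<Rightarrow> nat \<Rightarrow> poly2 set" where
  "MII e i = {a * (x1 ^ i - x2 ^ i) | a. a \<in> A2 e}"

definition J_image :: "nat \<Rightarrow> poly2 set \<Rightarrow> bool" where
  "J_image e M \<longleftrightarrow> (\<exists>N. simple_submod (D1 e) N \<and> mod_iso (D2 e) M (J e N))"

definition semi_inv_module :: "nat \<Rightarrow> poly2 set \<Rightarrow> bool" where
  "semi_inv_module e M \<longleftrightarrow> (\<exists>\<phi>. linear_char e \<phi> \<and> M = semi_invariants e \<phi>)"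

end

theory Submission
  imports Defs
begin

text \<open>
  Everything is governed by one computation. If no monomial of \<open>f\<close> has degree above \<open>c + d\<close>,
  then \<open>\<partial>\<^sub>1\<^sup>c \<partial>\<^sub>2\<^sup>d f\<close> is the constant \<open>c! d! f\<^sub>c\<^sub>d\<close>. Multiplying by the monomials \<open>x\<^sub>1\<^sup>a x\<^sub>2\<^sup>b\<close> with \<open>a - b\<close>
  congruent to \<open>c - d\<close> modulo \<open>e\<close> gives \<open>C\<^sub>e\<close>-invariant operators. Hence a submodule over the
  \<open>C\<^sub>e\<close>-invariant operators that contains \<open>f\<close> contains the whole \<open>\<rho>\<close>-eigenspace of the leading monomial
  (\<open>D1_submod_contains\<close>). The simple ones are therefore exactly the weight spaces \<open>wt e i\<close>, which are
  the modules \<open>N\<^sub>i\<close> (\<open>N_eq_wt\<close>). Adding to each operator its \<open>\<sigma>\<close>-conjugate shows in the same way that a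
  submodule over the dihedral-invariant operators containing \<open>f\<close> contains \<open>(\<alpha> + \<beta>\<sigma>) N\<^sub>i\<close>, where
  \<open>i = c - d\<close> and \<open>\<alpha>, \<beta>\<close> are the coefficients of \<open>f\<close> at \<open>(c, d)\<close> and \<open>(d, c)\<close> (\<open>D2_submod_contains\<close>).

  For the restriction, operators of negative degree kill the lowest monomials of \<open>N\<^sub>i\<close>. When
  \<open>0 < i < e\<close> such a monomial has distinct exponents, so \<open>\<alpha> = 1\<close> and \<open>\<beta> = 0\<close>, and it generates all of
  \<open>N\<^sub>i\<close> over the dihedral-invariant operators (\<open>J_N\<close>). When \<open>i = 0\<close> exactly the constants are killed,
  and they generate the symmetric part \<open>A\<^sub>2\<close> (\<open>J_N_0\<close>). The relations with \<open>x\<^sub>1\<^sup>e + x\<^sub>2\<^sup>e\<close> identify \<open>N\<^sub>i\<close>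
  with \<open>A\<^sub>2 x\<^sub>1\<^sup>i + A\<^sub>2 x\<^sub>2\<^sup>e\<^sup>-\<^sup>i\<close> (\<open>A2_span_eq_wt\<close>), which is \<open>M\<^sub>i\<^sup>1\<close> for \<open>0 < i < e/2\<close> and
  \<open>M\<^sub>e\<^sub>-\<^sub>i\<^sup>2\<close> for \<open>e/2 < i < e\<close>.
  For \<open>i = e/2\<close> the space is \<open>\<sigma>\<close>-stable, and its two eigenspaces are \<open>M\<^sup>I\<close> and \<open>M\<^sup>I\<^sup>I\<close>.

  A simple module over the dihedral-invariant operators is \<open>(\<alpha> + \<beta>\<sigma>) N\<^sub>i\<close> with \<open>\<alpha> \<noteq> 0\<close>. If \<open>2i\<close> is not
  divisible by \<open>e\<close>, then \<open>\<sigma>\<close> moves \<open>N\<^sub>i\<close> to a different weight space and \<open>\<alpha> + \<beta>\<sigma>\<close> is an isomorphism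
  from \<open>N\<^sub>i = J(N\<^sub>i)\<close>. Otherwise the module is one of the two \<open>\<sigma>\<close>-eigenspaces of \<open>N\<^sub>i\<close>
  (\<open>simple_D2_cases\<close>), and these are the modules of semi-invariants: \<open>A\<^sub>2 = J(N\<^sub>0)\<close> and \<open>M\<^sub>e\<close> for \<open>i = 0\<close>,
  \<open>M\<^sup>I\<close> and \<open>M\<^sup>I\<^sup>I\<close> for \<open>i = e/2\<close>. Except for \<open>A\<^sub>2\<close> they are not restrictions
  (\<open>sign_wt_not_J_image\<close>): \<open>x\<^sub>1 \<partial>\<^sub>1 + x\<^sub>2 \<partial>\<^sub>2\<close> and \<open>x\<^sub>1 x\<^sub>2 \<partial>\<^sub>1 \<partial>\<^sub>2\<close> are dihedral-invariant, and their joint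
  eigenvalues and multiplicities distinguish these eigenspaces from every \<open>J(N\<^sub>j)\<close>.
\<close>

section \<open>Linear operators on polynomials\<close>

abbreviation coeff :: "poly2 \<Rightarrow> nat \<Rightarrow> nat \<Rightarrow> complex" where
  "coeff f a b \<equiv> Poly_Mapping.lookup f (a, b)"

abbreviation monom2 :: "nat \<Rightarrow> nat \<Rightarrow> poly2" where
  "monom2 a b \<equiv> Poly_Mapping.single (a, b) 1"

lemma lookup_const_mult [simp]: "Poly_Mapping.lookup (const c * f) k = c * Poly_Mapping.lookup f k"
  unfolding const_def mult_map_scale_conv_mult [symmetric]
  by (simp add: Poly_Mapping.map.rep_eq when_def)

lemma const_add: "const (c + d) = const c + const d"
  by (simp add: const_def single_add)

lemma const_mult: "const (c * d) = const c * const d"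
  by (simp add: const_def mult_single)

lemma const_0 [simp]: "const 0 = 0" and const_1 [simp]: "const 1 = 1"
  by (simp_all add: const_def)

lemma const_mult_monom2: "const c * monom2 a b = Poly_Mapping.single (a, b) c"
  by (simp add: const_def mult_single zero_prod_def)

lemma monom2_mult: "monom2 a b * monom2 c d = monom2 (a + c) (b + d)"
  by (simp add: mult_single)

lemma x1_power: "x1 ^ n = monom2 n 0"
  by (induction n) (simp_all add: x1_def mult_single flip: zero_prod_def)

lemma x2_power: "x2 ^ n = monom2 0 n"
  by (induction n) (simp_all add: x2_def mult_single flip: zero_prod_def)

lemma coeff_monom2: "coeff (monom2 a b) p q = (if a = p \<and> b = q then 1 else 0)"
  by (simp add: lookup_single when_def)

definition lin_closed :: "poly2 set \<Rightarrow> bool" where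
  "lin_closed S \<longleftrightarrow> 0 \<in> S \<and> (\<forall>f\<in>S. \<forall>g\<in>S. f + g \<in> S) \<and> (\<forall>c. \<forall>f\<in>S. const c * f \<in> S)"

definition linear_op :: "(poly2 \<Rightarrow> poly2) \<Rightarrow> bool" where
  "linear_op P \<longleftrightarrow> (\<forall>f g. P (f + g) = P f + P g) \<and> (\<forall>c f. P (const c * f) = const c * P f)"

lemma lin_closed_sum:
  assumes "lin_closed S" "\<And>k. k \<in> A \<Longrightarrow> g k \<in> S"
  shows "sum g A \<in> S"
  using assms(2) by (induction A rule: infinite_finite_induct) (use assms(1) in \<open>auto simp: lin_closed_def\<close>)

lemma poly2_expand: "f = (\<Sum>(a, b)\<in>Poly_Mapping.keys f. const (coeff f a b) * monom2 a b)"
  by (rule poly_mapping_eqI)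
    (auto simp: lookup_sum const_mult_monom2 lookup_single when_def case_prod_unfold in_keys_iff)

lemma in_lin_closedI:
  assumes "lin_closed S" "\<And>a b. coeff f a b \<noteq> 0 \<Longrightarrow> monom2 a b \<in> S"
  shows "f \<in> S"
  by (subst poly2_expand, rule lin_closed_sum)
    (use assms in \<open>auto simp: in_keys_iff lin_closed_def\<close>)

lemma linear_opI:
  "\<lbrakk>\<And>f g. P (f + g) = P f + P g; \<And>c f. P (const c * f) = const c * P f\<rbrakk> \<Longrightarrow> linear_op P"
  by (simp add: linear_op_def)

lemma linear_op_add: "linear_op P \<Longrightarrow> P (f + g) = P f + P g"
  and linear_op_scale: "linear_op P \<Longrightarrow> P (const c * f) = const c * P f"
  by (simp_all add: linear_op_def)

lemma linear_op_0: "linear_op P \<Longrightarrow> P 0 = 0"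
  using linear_op_scale [of P 0 0] by simp

lemma linear_op_minus: "linear_op P \<Longrightarrow> P (- f) = - P f"
  using linear_op_add [of P f "- f"] linear_op_0 [of P] by (simp add: eq_neg_iff_add_eq_0 add.commute)

lemma linear_op_diff: "linear_op P \<Longrightarrow> P (f - g) = P f - P g"
  using linear_op_add [of P f "- g"] linear_op_minus [of P g] by simp

lemma linear_op_eqI:
  assumes "linear_op P" "linear_op Q" "\<And>a b. P (monom2 a b) = Q (monom2 a b)"
  shows "P = Q"
proof
  fix f
  have "lin_closed {f. P f = Q f}"
    using assms(1,2) by (auto simp: lin_closed_def linear_op_add linear_op_scale linear_op_0)
  then show "P f = Q f"
    using in_lin_closedI [of "{f. P f = Q f}" f] assms(3) by auto
qed

lemma linear_op_compose: "linear_op P \<Longrightarrow> linear_op Q \<Longrightarrow> linear_op (P \<circ> Q)"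
  by (simp add: linear_op_def)

lemma linear_op_plus: "linear_op P \<Longrightarrow> linear_op Q \<Longrightarrow> linear_op (\<lambda>f. P f + Q f)"
  by (simp add: linear_op_def algebra_simps)

lemma linear_op_times: "linear_op (\<lambda>f. h * f)"
  by (simp add: linear_op_def algebra_simps)

text \<open>
  The operators \<open>\<partial>\<^sub>i\<close> and the substitutions are given by sums over the keys of their argument, a
  form whose additivity is not visible. Writing them as linear extensions makes them determined
  by their values on monomials.
\<close>
definition lin_ext :: "(nat \<times> nat \<Rightarrow> poly2) \<Rightarrow> poly2 \<Rightarrow> poly2" where
  "lin_ext g f = (\<Sum>k\<in>Poly_Mapping.keys f. const (Poly_Mapping.lookup f k) * g k)"

lemma linear_op_lin_ext: "linear_op (lin_ext g)"
proof (rule linear_opI)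
  show "lin_ext g (f + h) = lin_ext g f + lin_ext g h" for f h
    unfolding lin_ext_def
    by (rule setsum_keys_plus_distrib) (simp_all add: const_add algebra_simps)
  show "lin_ext g (const c * f) = const c * lin_ext g f" for c f
  proof -
    have "lin_ext g (const c * f) =
        (\<Sum>k\<in>Poly_Mapping.keys f. const (Poly_Mapping.lookup (const c * f) k) * g k)"
      unfolding lin_ext_def by (rule sum.mono_neutral_left) (auto simp: in_keys_iff)
    then show ?thesis
      by (simp add: lin_ext_def sum_distrib_left const_mult mult.assoc)
  qed
qed

lemma lin_ext_monom2 [simp]: "lin_ext g (monom2 a b) = g (a, b)"
  by (simp add: lin_ext_def)

lemma subst2_eq_lin_ext: "subst2 p q = lin_ext (\<lambda>(a, b). p ^ a * q ^ b)"
  by (rule ext) (simp add: subst2_def lin_ext_def case_prod_unfold mult.assoc)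

lemma d1_eq_lin_ext: "d1 = lin_ext (\<lambda>(a, b). const (of_nat a) * monom2 (a - 1) b)"
  by (rule ext) (simp add: d1_def lin_ext_def case_prod_unfold const_def mult_single
    zero_prod_def mult.commute)

lemma d2_eq_lin_ext: "d2 = lin_ext (\<lambda>(a, b). const (of_nat b) * monom2 a (b - 1))"
  by (rule ext) (simp add: d2_def lin_ext_def case_prod_unfold const_def mult_single
    zero_prod_def mult.commute)

lemma linear_op_d1: "linear_op d1" and linear_op_d2: "linear_op d2"
  by (simp_all add: d1_eq_lin_ext d2_eq_lin_ext linear_op_lin_ext)

lemma d1_monom2: "d1 (monom2 a b) = const (of_nat a) * monom2 (a - 1) b"
  and d2_monom2: "d2 (monom2 a b) = const (of_nat b) * monom2 a (b - 1)"
  by (simp_all add: d1_eq_lin_ext d2_eq_lin_ext)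

lemma weyl_linear: "P \<in> weyl \<Longrightarrow> linear_op P"
  by (induction rule: weyl.induct)
    (blast intro: linear_op_times linear_op_d1 linear_op_d2 linear_op_plus linear_op_compose)+

section \<open>The dihedral action on coefficients\<close>

lemma const_power: "const (c ^ n) = const c ^ n"
  by (induction n) (simp_all add: const_mult)

lemma linear_op_rho: "linear_op (rho e)" and linear_op_sigma: "linear_op sigma"
  by (simp_all add: rho_def sigma_def subst2_eq_lin_ext linear_op_lin_ext)

lemma eps_nonzero [simp]: "eps e \<noteq> 0"
  by (simp add: eps_def)

lemma rho_monom2: "rho e (monom2 a b) = const (eps e powi (int a - int b)) * monom2 a b"
proof -
  have "rho e (monom2 a b) = const (eps e ^ a * inverse (eps e) ^ b) * (x1 ^ a * x2 ^ b)"
    by (simp add: rho_def subst2_eq_lin_ext power_mult_distrib const_power const_mult mult_ac)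
  moreover have "eps e ^ a * inverse (eps e) ^ b = eps e powi (int a - int b)"
    by (simp add: power_int_diff power_inverse field_simps)
  ultimately show ?thesis
    by (simp add: x1_power x2_power monom2_mult)
qed

lemma sigma_monom2 [simp]: "sigma (monom2 a b) = monom2 b a"
  by (simp add: sigma_def subst2_eq_lin_ext x1_power x2_power mult_single)

text \<open>
  Several operators compute a coefficient of the image from a single coefficient of the argument.
  Such a formula only has to be checked on monomials.
\<close>
lemma coeff_linear_opI:
  assumes "linear_op P" "\<And>c d. Poly_Mapping.lookup (P (monom2 c d)) k = g c d * Poly_Mapping.lookup (monom2 c d) l"
  shows "Poly_Mapping.lookup (P f) k = g (fst l) (snd l) * Poly_Mapping.lookup f l"
proof -
  let ?S = "{f. Poly_Mapping.lookup (P f) k = g (fst l) (snd l) * Poly_Mapping.lookup f l}"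
  have "lin_closed ?S"
    using assms(1)
    by (auto simp: lin_closed_def linear_op_add linear_op_scale linear_op_0 lookup_add distrib_left)
  moreover have "monom2 c d \<in> ?S" for c d
    using assms(2) [of c d] by (cases l) (auto simp: lookup_single when_def)
  ultimately show ?thesis
    using in_lin_closedI [of ?S f] by auto
qed

lemma coeff_rho: "coeff (rho e f) a b = eps e powi (int a - int b) * coeff f a b"
  using coeff_linear_opI [OF linear_op_rho,
      of e "(a, b)" "\<lambda>a b. eps e powi (int a - int b)" "(a, b)" f]
  by (simp add: rho_monom2)

lemma coeff_sigma [simp]: "coeff (sigma f) a b = coeff f b a"
  using coeff_linear_opI [OF linear_op_sigma, of "(a, b)" "\<lambda>_ _. 1" "(b, a)" f]
  by (simp add: lookup_single when_def eq_commute conj_commute)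

lemma sigma_sigma [simp]: "sigma (sigma f) = f"
  by (rule poly_mapping_eqI) auto

text \<open>
  \<open>\<epsilon>\<close> is a primitive \<open>e\<close>-th root of unity, so the eigenvalue of \<open>\<rho>\<close> on a monomial determines its
  weight modulo \<open>e\<close>.
\<close>
lemma eps_powi_eq_1_iff:
  assumes "e \<ge> 1"
  shows "eps e powi k = 1 \<longleftrightarrow> int e dvd k"
proof -
  have eq: "eps e powi k = cis (2 * pi * of_int k / of_nat e)"
  proof -
    have "eps e = cis (2 * pi / of_nat e)"
      by (simp add: eps_def cis_conv_exp mult.commute mult.left_commute)
    then show ?thesis
      by (simp add: cis_power_int mult.commute)
  qed
  show ?thesis
  proof
    assume "eps e powi k = 1"
    then have "cos (2 * pi * of_int k / of_nat e) = 1"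
      unfolding eq by (metis cis.simps(1) one_complex.simps(1))
    then obtain n :: int where "2 * pi * of_int k / of_nat e = of_int n * 2 * pi"
      by (auto simp: cos_one_2pi_int)
    then have "of_int k = (of_int (n * int e) :: real)"
      using assms by (simp add: field_simps)
    then show "int e dvd k"
      by (metis dvd_triv_right of_int_eq_iff)
  next
    assume "int e dvd k"
    then obtain n where "k = int e * n" ..
    then have "2 * pi * of_int k / of_nat e = 2 * pi * of_int n"
      using assms by simp
    then show "eps e powi k = 1"
      unfolding eq by (simp only: complex_eq_iff cis.simps cos_int_2pin sin_int_2pin) simp
  qed
qed

lemma bij_rho: "bij (rho e)"
proof (rule o_bij)
  let ?r = "lin_ext (\<lambda>(a, b). const (eps e powi (int b - int a)) * monom2 a b)"
  have *: "linear_op id"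
    by (simp add: linear_op_def)
  have **: "const (eps e powi (int b - int a)) * (const (eps e powi (int a - int b)) * f) = f" for a b f
    by (simp flip: mult.assoc const_mult power_int_add)
  show "?r \<circ> rho e = id"
    by (rule linear_op_eqI)
      (auto intro!: linear_op_compose linear_op_lin_ext linear_op_rho *
         simp: rho_monom2 linear_op_scale [OF linear_op_lin_ext] **)
  show "rho e \<circ> ?r = id"
    by (rule linear_op_eqI)
      (auto intro!: linear_op_compose linear_op_lin_ext linear_op_rho *
         simp: rho_monom2 linear_op_scale [OF linear_op_rho] **)
qed

lemma bij_sigma: "bij sigma"
  by (rule o_bij [of sigma]) auto

text \<open>
  Induction over a generated group of bijections, with the operations of the group record
  replaced by composition and inversion of functions.
\<close>
lemma generate_BijGroup_induct [consumes 1, case_names gen bij id inv comp]: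
  assumes "g \<in> generate (BijGroup UNIV) H"
    and "\<And>h. h \<in> H \<Longrightarrow> Q h" and "\<And>h. h \<in> H \<Longrightarrow> bij h"
    and "Q id" "\<And>h. bij h \<Longrightarrow> Q h \<Longrightarrow> Q (inv_into UNIV h)"
    and "\<And>h k. bij h \<Longrightarrow> bij k \<Longrightarrow> Q h \<Longrightarrow> Q k \<Longrightarrow> Q (h \<circ> k)"
  shows "bij g \<and> Q g"
  using assms(1)
proof (induction rule: generate.induct)
  case one
  show ?case
    using assms(4) by (simp add: BijGroup_def restrict_UNIV id_def [symmetric])
next
  case (incl h)
  then show ?case using assms by auto
next
  case (inv h)
  then have "bij h"
    using assms by auto
  then have "inv\<^bsub>BijGroup UNIV\<^esub> h = inv_into UNIV h"
    by (subst inv_BijGroup) (auto simp: Bij_def extensional_def restrict_UNIV)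
  then show ?case
    using assms(2,5) inv \<open>bij h\<close> by (simp add: bij_imp_bij_inv)
next
  case (eng h1 h2)
  then have "h1 \<otimes>\<^bsub>BijGroup UNIV\<^esub> h2 = h1 \<circ> h2"
    by (auto simp: BijGroup_def Bij_def extensional_def restrict_UNIV compose_def)
  then show ?case
    using eng assms(6) by (metis bij_comp)
qed

lemma commute_generate:
  assumes "g \<in> generate (BijGroup UNIV) H" "\<And>h. h \<in> H \<Longrightarrow> bij h \<and> h \<circ> P = P \<circ> h"
  shows "bij g \<and> g \<circ> P = P \<circ> g"
  using assms(1)
proof (induction rule: generate_BijGroup_induct)
  case (inv h)
  show ?case
  proof
    fix f
    have "h (P (inv_into UNIV h f)) = P (h (inv_into UNIV h f))"
      using inv(2) by (simp add: fun_eq_iff)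
    also have "\<dots> = P f"
      using inv(1) by (simp add: bij_is_surj surj_f_inv_f)
    finally show "(inv_into UNIV h \<circ> P) f = (P \<circ> inv_into UNIV h) f"
      using inv(1) by (simp add: inv_f_eq bij_is_inj)
  qed
next
  case (comp h k)
  then show ?case by (simp add: fun_eq_iff)
qed (use assms(2) in auto)

lemma fixes_generate:
  assumes "g \<in> generate (BijGroup UNIV) H" "\<And>h. h \<in> H \<Longrightarrow> bij h \<and> h f = f"
  shows "g f = f"
proof -
  have "bij g \<and> g f = f"
    using assms(1)
    by (induction rule: generate_BijGroup_induct) (use assms(2) in \<open>auto simp: inv_f_eq bij_is_inj\<close>)
  then show ?thesis ..
qed

lemma conj_eq_iff: "bij g \<Longrightarrow> g \<circ> P \<circ> inv_into UNIV g = P \<longleftrightarrow> g \<circ> P = P \<circ> g"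
proof
  assume g: "bij g" and eq: "g \<circ> P \<circ> inv_into UNIV g = P"
  have "(g \<circ> P) f = (g \<circ> P \<circ> inv_into UNIV g) (g f)" for f
    using g by (simp add: bij_is_inj)
  then show "g \<circ> P = P \<circ> g"
    unfolding eq by auto
next
  assume g: "bij g" and eq: "g \<circ> P = P \<circ> g"
  show "g \<circ> P \<circ> inv_into UNIV g = P"
    unfolding eq using g by (simp add: fun_eq_iff bij_is_surj surj_f_inv_f)
qed

text \<open>
  The bijections that commute with \<open>P\<close> form a group, so invariance under a group amounts to
  commutation with its generators.
\<close>
lemma weyl_inv_generate:
  assumes "\<forall>h\<in>H. bij h"
  shows "weyl_inv (generate (BijGroup UNIV) H) = {P \<in> weyl. \<forall>h\<in>H. h \<circ> P = P \<circ> h}"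
proof (intro Set.set_eqI iffI)
  fix P assume "P \<in> weyl_inv (generate (BijGroup UNIV) H)"
  then show "P \<in> {P \<in> weyl. \<forall>h\<in>H. h \<circ> P = P \<circ> h}"
    by (auto simp: weyl_inv_def assms generate.incl simp flip: conj_eq_iff)
next
  fix P assume *: "P \<in> {P \<in> weyl. \<forall>h\<in>H. h \<circ> P = P \<circ> h}"
  then have "bij g \<and> g \<circ> P = P \<circ> g" if "g \<in> generate (BijGroup UNIV) H" for g
    using commute_generate [OF that, of P] assms by auto
  then show "P \<in> weyl_inv (generate (BijGroup UNIV) H)"
    using * by (auto simp: weyl_inv_def conj_eq_iff)
qed

lemma bij_generators: "\<forall>h\<in>{rho e}. bij h" "\<forall>h\<in>{rho e, sigma}. bij h"
  using bij_rho bij_sigma by auto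

lemma D1_iff: "P \<in> D1 e \<longleftrightarrow> P \<in> weyl \<and> (\<forall>f. rho e (P f) = P (rho e f))"
  unfolding D1_def cyc_def weyl_inv_generate [OF bij_generators(1)]
  by (simp add: fun_eq_iff [of "_ \<circ> _"])

lemma D2_iff: "P \<in> D2 e \<longleftrightarrow> P \<in> D1 e \<and> (\<forall>f. sigma (P f) = P (sigma f))"
  unfolding D1_iff D2_def dih_def weyl_inv_generate [OF bij_generators(2)]
  by (auto simp: fun_eq_iff)

lemma invariants_generate:
  assumes "\<forall>h\<in>H. bij h"
  shows "invariants (generate (BijGroup UNIV) H) = {f. \<forall>h\<in>H. h f = f}"
proof (intro Set.set_eqI iffI)
  fix f assume "f \<in> {f. \<forall>h\<in>H. h f = f}"
  then show "f \<in> invariants (generate (BijGroup UNIV) H)"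
    using assms fixes_generate [of _ H f] by (simp add: invariants_def)
qed (simp add: invariants_def generate.incl)

section \<open>Weight spaces of the cyclic group\<close>

text \<open>
  The eigenspace of \<open>\<rho>\<close> for the eigenvalue \<open>\<epsilon>\<^sup>i\<close>, described by monomials so that membership can be
  read off the coefficients.
\<close>
definition wt :: "nat \<Rightarrow> int \<Rightarrow> poly2 set" where
  "wt e i = {f. \<forall>a b. coeff f a b \<noteq> 0 \<longrightarrow> int e dvd int a - int b - i}"

text \<open>
  When \<open>2i\<close> is divisible by \<open>e\<close>, the weight space \<open>wt e i\<close> is stable under \<open>\<sigma>\<close>, and for
  \<open>s = 1\<close> and \<open>s = -1\<close> these are isotypic components of the linear characters of the dihedral group.
\<close>
definition sign_wt :: "nat \<Rightarrow> complex \<Rightarrow> int \<Rightarrow> poly2 set" where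
  "sign_wt e s i = {f \<in> wt e i. sigma f = const s * f}"

lemma wt_iff_rho:
  assumes "e \<ge> 1"
  shows "f \<in> wt e i \<longleftrightarrow> rho e f = const (eps e powi i) * f"
proof -
  have "eps e powi k * z = eps e powi i * z \<longleftrightarrow> z = 0 \<or> int e dvd k - i" for k z
    using eps_powi_eq_1_iff [OF assms, of "k - i"] by (auto simp: power_int_diff)
  then show ?thesis
    by (auto simp: wt_def poly_mapping_eq_iff fun_eq_iff coeff_rho)
qed

lemma A1_eq: "e \<ge> 1 \<Longrightarrow> A1 e = wt e 0"
  unfolding A1_def cyc_def invariants_generate [OF bij_generators(1)] by (auto simp: wt_iff_rho)

lemma A2_eq: "e \<ge> 1 \<Longrightarrow> A2 e = sign_wt e 1 0"
  unfolding A2_def dih_def invariants_generate [OF bij_generators(2)]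
  by (auto simp: wt_iff_rho sign_wt_def)

lemma lin_closed_wt: "lin_closed (wt e i)"
proof -
  have "coeff f a b \<noteq> 0 \<or> coeff g a b \<noteq> 0" if "coeff (f + g) a b \<noteq> 0" for f g a b
    using that by (auto simp: lookup_add)
  then show ?thesis
    unfolding lin_closed_def wt_def by (simp, blast)
qed

lemma wt_cong: "int e dvd i - j \<Longrightarrow> wt e i = wt e j"
proof -
  assume "int e dvd i - j"
  then have "int e dvd x - i \<longleftrightarrow> int e dvd x - j" for x
    using dvd_add_left_iff [of "int e" "i - j" "x - i"] by simp
  then show ?thesis by (simp add: wt_def)
qed

lemma wt_nat:
  assumes "e \<ge> 1" obtains k where "k < e" "wt e i = wt e (int k)"
proof
  show "nat (i mod int e) < e"
    using assms by (simp add: nat_less_iff)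
  show "wt e i = wt e (int (nat (i mod int e)))"
    using assms by (intro wt_cong) (simp add: minus_mod_eq_mult_div)
qed

lemma monom2_wt [simp]: "monom2 a b \<in> wt e i \<longleftrightarrow> int e dvd int a - int b - i"
  by (auto simp: wt_def coeff_monom2 split: if_splits)

lemma wt_mult:
  assumes "f \<in> wt e i" "g \<in> wt e j"
  shows "f * g \<in> wt e (i + j)"
  unfolding wt_def
proof (intro CollectI allI impI)
  fix a b assume "coeff (f * g) a b \<noteq> 0"
  then have "(a, b) \<in> Poly_Mapping.keys (f * g)"
    by (simp add: in_keys_iff)
  then obtain k l where "(a, b) = k + l" "k \<in> Poly_Mapping.keys f" "l \<in> Poly_Mapping.keys g"
    using keys_mult [of f g] by blast
  then obtain p q r s where "coeff f p q \<noteq> 0" "coeff g r s \<noteq> 0" "a = p + r" "b = q + s"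
    by (cases k; cases l) (auto simp: in_keys_iff)
  then have "int e dvd (int p - int q - i) + (int r - int s - j)"
    using assms by (intro dvd_add) (auto simp: wt_def)
  then show "int e dvd int a - int b - (i + j)"
    using \<open>a = _\<close> \<open>b = _\<close> by (simp add: algebra_simps)
qed

lemma sigma_wt: "f \<in> wt e i \<Longrightarrow> sigma f \<in> wt e (- i)"
  unfolding wt_def
proof (intro CollectI allI impI)
  fix a b assume "f \<in> {f. \<forall>a b. coeff f a b \<noteq> 0 \<longrightarrow> int e dvd int a - int b - i}" "coeff (sigma f) a b \<noteq> 0"
  then have "int e dvd int b - int a - i" by auto
  then have "int e dvd - (int b - int a - i)" by (simp only: dvd_minus_iff)
  then show "int e dvd int a - int b - - i" by (simp add: algebra_simps)
qed

lemma D1_linear: "P \<in> D1 e \<Longrightarrow> linear_op P" and D2_linear: "P \<in> D2 e \<Longrightarrow> linear_op P"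
  by (auto simp: D1_iff D2_iff weyl_linear)

text \<open>
  A \<open>C\<^sub>e\<close>-invariant operator commutes with \<open>\<rho>\<close> and therefore preserves its eigenspaces.
\<close>
lemma D1_wt: "e \<ge> 1 \<Longrightarrow> P \<in> D1 e \<Longrightarrow> f \<in> wt e i \<Longrightarrow> P f \<in> wt e i"
  by (simp add: wt_iff_rho D1_iff linear_op_scale weyl_linear)

lemma D1_const: "(\<lambda>f. const c * f) \<in> D1 e" and D2_const: "(\<lambda>f. const c * f) \<in> D2 e"
  by (auto simp: D1_iff D2_iff weyl.intros linear_op_scale [OF linear_op_rho] linear_op_scale [OF linear_op_sigma])

lemma D2_plus: "P \<in> D2 e \<Longrightarrow> Q \<in> D2 e \<Longrightarrow> (\<lambda>f. P f + Q f) \<in> D2 e"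
  and D2_comp: "P \<in> D2 e \<Longrightarrow> Q \<in> D2 e \<Longrightarrow> P \<circ> Q \<in> D2 e"
  by (auto simp: D1_iff D2_iff weyl.intros linear_op_add [OF linear_op_rho] linear_op_add [OF linear_op_sigma])

lemma submod_lin_closed: "submod (D1 e) M \<Longrightarrow> lin_closed M" "submod (D2 e) M \<Longrightarrow> lin_closed M"
  using D1_const D2_const by (auto simp: submod_def lin_closed_def)

section \<open>Normally ordered monomials of the Weyl algebra\<close>

text \<open>
  The falling factorial \<open>p (p - 1) \<dots> (p - c + 1)\<close>: the truncated subtraction turns it into \<open>0\<close> for
  \<open>p < c\<close>, which is the coefficient of the \<open>c\<close>-th derivative of \<open>x\<^sup>p\<close> in that case.
\<close>
definition falling :: "nat \<Rightarrow> nat \<Rightarrow> complex" where "falling p c = (\<Prod>j<c. of_nat (p - j))"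

lemma falling_eq_0_iff [simp]: "falling p c = 0 \<longleftrightarrow> p < c"
  by (auto simp: falling_def)

lemma falling_simps [simp]: "falling p 0 = 1" "falling p (Suc 0) = of_nat p"
  by (simp_all add: falling_def)

definition normal_op :: "nat \<Rightarrow> nat \<Rightarrow> nat \<Rightarrow> nat \<Rightarrow> poly2 \<Rightarrow> poly2" where
  "normal_op a b c d = (\<lambda>f. monom2 a b * f) \<circ> ((d1 ^^ c) \<circ> (d2 ^^ d))"

text \<open>
  The second summand is the conjugate of the first under \<open>\<sigma>\<close> (\<open>sigma_normal_op\<close> below).
\<close>
definition sym_op :: "nat \<Rightarrow> nat \<Rightarrow> nat \<Rightarrow> nat \<Rightarrow> poly2 \<Rightarrow> poly2" where
  "sym_op a b c d f = normal_op a b c d f + normal_op b a d c f"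

lemma weyl_part_weyl: "weyl_part d P \<Longrightarrow> P \<in> weyl"
  by (induction rule: weyl_part.induct) (blast intro: weyl.intros)+

lemma weyl_part_power:
  assumes "weyl_part d P"
  shows "weyl_part (int n * d) (P ^^ n)"
proof (induction n)
  case 0
  have "(\<lambda>f. const 1 * f) = P ^^ 0" by auto
  then show ?case using weyl_part.intros(1) [of 1] by simp
next
  case (Suc n)
  have "int (Suc n) * d = d + int n * d"
    by (simp add: algebra_simps)
  then show ?case
    using weyl_part.intros(7) [OF assms Suc] by (simp only: funpow.simps)
qed

lemma weyl_part_normal_op: "weyl_part (int a + int b - int c - int d) (normal_op a b c d)"
proof -
  have pow: "((\<lambda>f. x * f) ^^ n) f = x ^ n * f" for x f :: poly2 and n
    by (induction n) (simp_all add: mult_ac)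
  have "((\<lambda>f. x1 * f) ^^ a) \<circ> ((\<lambda>f. x2 * f) ^^ b) = (\<lambda>f. monom2 a b * f)"
    by (auto simp: pow x1_power x2_power mult_single simp flip: mult.assoc)
  then have "weyl_part (int a * 1 + int b * 1) (\<lambda>f. monom2 a b * f)"
    using weyl_part.intros(7) [OF weyl_part_power [OF weyl_part.intros(2), of a]
        weyl_part_power [OF weyl_part.intros(3), of b]] by simp
  from weyl_part.intros(7) [OF this weyl_part.intros(7) [OF weyl_part_power [OF weyl_part.intros(4), of c]
        weyl_part_power [OF weyl_part.intros(5), of d]]]
  show ?thesis by (simp add: normal_op_def algebra_simps)
qed

lemma linear_op_normal_op: "linear_op (normal_op a b c d)" and linear_op_sym_op: "linear_op (sym_op a b c d)"
proof -
  show *: "linear_op (normal_op a b c d)" for a b c d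
    by (rule weyl_linear [OF weyl_part_weyl [OF weyl_part_normal_op]])
  show "linear_op (sym_op a b c d)"
    using linear_op_plus [OF * *] by (simp add: sym_op_def [abs_def])
qed

lemma normal_op_monom2: "normal_op a b c d (monom2 p q) = const (falling p c * falling q d) * monom2 (a + (p - c)) (b + (q - d))"
proof -
  have 1: "(d1 ^^ c) (monom2 p q) = const (falling p c) * monom2 (p - c) q" for p q
    by (induction c) (simp_all add: linear_op_scale [OF linear_op_d1] d1_monom2 falling_def const_mult mult.assoc)
  have 2: "(d2 ^^ d) (monom2 p q) = const (falling q d) * monom2 p (q - d)"
    by (induction d) (simp_all add: linear_op_scale [OF linear_op_d2] d2_monom2 falling_def const_mult mult.assoc)
  have 3: "linear_op (d1 ^^ c)"
    by (induction c) (simp_all add: linear_op_def linear_op_d1 [unfolded linear_op_def])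
  show ?thesis
    by (simp add: normal_op_def 1 2 linear_op_scale [OF 3] const_mult mult_single
        mult.left_commute [of "monom2 a b"])
qed

text \<open>
  The operator changes the weight by \<open>(a - b) - (c - d)\<close>. Where the truncated exponents do not
  reflect this, the falling factorials vanish.
\<close>
lemma normal_op_D1:
  assumes "e \<ge> 1" "int e dvd (int a - int b) - (int c - int d)"
  shows "normal_op a b c d \<in> D1 e"
proof -
  have "rho e \<circ> normal_op a b c d = normal_op a b c d \<circ> rho e"
  proof (rule linear_op_eqI)
    fix p q
    show "(rho e \<circ> normal_op a b c d) (monom2 p q) = (normal_op a b c d \<circ> rho e) (monom2 p q)"
    proof (cases "c \<le> p \<and> d \<le> q")
      case True
      then have "int e dvd int (a + (p - c)) - int (b + (q - d)) - (int p - int q)"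
        using assms(2) by (simp add: of_nat_diff algebra_simps)
      then have "monom2 (a + (p - c)) (b + (q - d)) \<in> wt e (int p - int q)"
        by simp
      then have "normal_op a b c d (monom2 p q) \<in> wt e (int p - int q)"
        using lin_closed_wt unfolding normal_op_monom2 lin_closed_def by blast
      then have "rho e (normal_op a b c d (monom2 p q)) = const (eps e powi (int p - int q)) * normal_op a b c d (monom2 p q)"
        using assms(1) by (simp only: wt_iff_rho)
      then show ?thesis
        by (simp add: rho_monom2 linear_op_scale [OF linear_op_normal_op])
    next
      case False
      then have "falling p c * falling q d = 0" by auto
      then have "normal_op a b c d (monom2 p q) = 0"
        unfolding normal_op_monom2 by (metis const_0 mult_zero_left)
      then show ?thesis
        by (simp add: rho_monom2 linear_op_0 [OF linear_op_rho] linear_op_scale [OF linear_op_normal_op])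
    qed
  qed (auto intro: linear_op_compose linear_op_normal_op linear_op_rho)
  then show ?thesis
    by (auto simp: D1_iff weyl_part_weyl [OF weyl_part_normal_op] fun_eq_iff)
qed

lemma sigma_normal_op: "sigma (normal_op a b c d f) = normal_op b a d c (sigma f)"
proof -
  have "sigma \<circ> normal_op a b c d = normal_op b a d c \<circ> sigma"
    by (rule linear_op_eqI)
      (auto intro: linear_op_compose linear_op_normal_op linear_op_sigma
        simp: normal_op_monom2 linear_op_scale [OF linear_op_sigma] mult.commute [of "falling _ c" "falling _ d"])
  then show ?thesis
    by (auto simp: fun_eq_iff)
qed

lemma sym_op_D2:
  assumes "e \<ge> 1" "int e dvd (int a - int b) - (int c - int d)"
  shows "sym_op a b c d \<in> D2 e"
proof -
  have "int e dvd - ((int a - int b) - (int c - int d))"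
    using assms(2) by (simp only: dvd_minus_iff)
  then have "normal_op b a d c \<in> D1 e"
    using assms(1) by (intro normal_op_D1) (simp_all add: algebra_simps)
  then show ?thesis
    using normal_op_D1 [OF assms]
    by (auto simp: D2_iff D1_iff sym_op_def [abs_def] weyl.intros linear_op_add [OF linear_op_rho]
        linear_op_add [OF linear_op_sigma] sigma_normal_op)
qed

section \<open>Leading terms and generated submodules\<close>

text \<open>
  \<open>(c, d)\<close> need not be an exponent of \<open>f\<close>; this keeps the notion symmetric in \<open>c\<close> and \<open>d\<close>, so that it
  also applies at \<open>(d, c)\<close>.
\<close>
definition top_at :: "poly2 \<Rightarrow> nat \<Rightarrow> nat \<Rightarrow> bool" where
  "top_at f c d \<longleftrightarrow> (\<forall>p q. coeff f p q \<noteq> 0 \<longrightarrow> p + q \<le> c + d)"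

text \<open>
  \<open>\<partial>\<^sub>1\<^sup>c \<partial>\<^sub>2\<^sup>d\<close> annihilates every monomial of degree at most \<open>c + d\<close> except \<open>x\<^sub>1\<^sup>c x\<^sub>2\<^sup>d\<close>, so it extracts
  one leading coefficient of an arbitrary polynomial. This isolates a single monomial without
  decomposing \<open>f\<close> into eigenvectors of Euler operators.
\<close>
lemma normal_op_top:
  assumes "top_at f c d"
  shows "normal_op a b c d f = const (falling c c * falling d d * coeff f c d) * monom2 a b"
proof -
  define g where "g = f - const (coeff f c d) * monom2 c d"
  have "lin_closed {g. normal_op a b c d g = 0}"
    by (auto simp: lin_closed_def linear_op_add [OF linear_op_normal_op] linear_op_scale [OF linear_op_normal_op]
      linear_op_0 [OF linear_op_normal_op])
  moreover have "normal_op a b c d (monom2 p q) = 0" if "coeff g p q \<noteq> 0" for p q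
  proof -
    have "(p, q) \<noteq> (c, d)" "coeff f p q \<noteq> 0"
      using that by (auto simp: g_def lookup_minus coeff_monom2 split: if_splits)
    then have "falling p c * falling q d = 0"
      using assms by (force simp: top_at_def)
    then show ?thesis
      unfolding normal_op_monom2 by (metis const_0 mult_zero_left)
  qed
  ultimately have "normal_op a b c d g = 0"
    using in_lin_closedI [of "{g. normal_op a b c d g = 0}" g] by auto
  then have "normal_op a b c d f = const (coeff f c d) * normal_op a b c d (monom2 c d)"
    by (simp add: g_def linear_op_diff [OF linear_op_normal_op] linear_op_scale [OF linear_op_normal_op])
  then show ?thesis
    by (simp add: normal_op_monom2 const_mult mult_ac)
qed

text \<open>
  After symmetrisation two leading coefficients survive, those at \<open>(c, d)\<close> and at \<open>(d, c)\<close>, which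
  have the same total degree.
\<close>
lemma sym_op_top:
  assumes "top_at f c d"
  shows "sym_op a b c d f = const (falling c c * falling d d) * (const (coeff f c d) * monom2 a b + const (coeff f d c) * monom2 b a)"
proof -
  have "top_at f d c" using assms by (simp add: top_at_def add.commute)
  from normal_op_top [OF this] normal_op_top [OF assms] show ?thesis
    by (simp add: sym_op_def const_mult algebra_simps)
qed

lemma obtain_top:
  assumes "f \<noteq> 0"
  obtains c d where "coeff f c d \<noteq> 0" "top_at f c d"
proof -
  let ?A = "(\<lambda>(p, q). p + q) ` Poly_Mapping.keys f"
  have "Poly_Mapping.keys f \<noteq> {}"
    using assms by simp
  then have "Max ?A \<in> ?A"
    by (intro Max_in) auto
  then obtain c d where "(c, d) \<in> Poly_Mapping.keys f" "Max ?A = c + d"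
    by auto
  moreover have "p + q \<le> Max ?A" if "coeff f p q \<noteq> 0" for p q
    using that by (intro Max_ge) (auto simp: in_keys_iff image_iff intro!: bexI [of _ "(p, q)"])
  ultimately show ?thesis
    using that by (auto simp: in_keys_iff top_at_def)
qed

text \<open>
  The image of a weight space under \<open>\<alpha> + \<beta>\<sigma>\<close>. Dihedral-invariant operators commute with \<open>\<sigma>\<close>, so
  this is a \<open>D\<^sub>2\<close>-submodule; every simple one turns out to have this form.
\<close>
definition twist :: "nat \<Rightarrow> complex \<Rightarrow> complex \<Rightarrow> int \<Rightarrow> poly2 set" where
  "twist e \<alpha> \<beta> i = (\<lambda>f. const \<alpha> * f + const \<beta> * sigma f) ` wt e i"

lemma lin_closed_scale_iff: "lin_closed S \<Longrightarrow> c \<noteq> 0 \<Longrightarrow> const c * f \<in> S \<longleftrightarrow> f \<in> S"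
proof
  assume "lin_closed S" "c \<noteq> 0" "const c * f \<in> S"
  then have "const (inverse c) * (const c * f) \<in> S"
    by (simp add: lin_closed_def)
  then show "f \<in> S"
    using \<open>c \<noteq> 0\<close> by (simp flip: mult.assoc const_mult)
qed (simp add: lin_closed_def)

text \<open>
  From \<open>f\<close> the operators \<open>x\<^sub>1\<^sup>a x\<^sub>2\<^sup>b \<partial>\<^sub>1\<^sup>c \<partial>\<^sub>2\<^sup>d\<close> with \<open>a - b\<close> congruent to \<open>c - d\<close> modulo \<open>e\<close> produce
  nonzero multiples of all monomials of that weight.
\<close>
lemma D1_submod_contains:
  assumes "e \<ge> 1" "submod (D1 e) M" "f \<in> M" "top_at f c d" "coeff f c d \<noteq> 0"
  shows "wt e (int c - int d) \<subseteq> M"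
proof
  fix g assume g: "g \<in> wt e (int c - int d)"
  note lc = submod_lin_closed(1) [OF assms(2)]
  show "g \<in> M"
  proof (rule in_lin_closedI [OF lc])
    fix a b assume "coeff g a b \<noteq> 0"
    then have "normal_op a b c d f \<in> M"
      using g assms(1-3) normal_op_D1 by (auto simp: wt_def submod_def)
    then show "monom2 a b \<in> M"
      using assms(5) by (simp add: normal_op_top [OF assms(4)] lin_closed_scale_iff [OF lc])
  qed
qed

text \<open>
  With the symmetrised operators each monomial \<open>m\<close> of the weight of \<open>(c, d)\<close> is only obtained in
  the combination \<open>\<alpha> m + \<beta> \<sigma>(m)\<close>, where \<open>\<alpha>\<close> and \<open>\<beta>\<close> are the two leading coefficients of \<open>f\<close>.
\<close>
lemma D2_submod_contains:
  assumes "e \<ge> 1" "submod (D2 e) M" "f \<in> M" "top_at f c d"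
  shows "twist e (coeff f c d) (coeff f d c) (int c - int d) \<subseteq> M"
proof -
  define t where "t = (\<lambda>g. const (coeff f c d) * g + const (coeff f d c) * sigma g)"
  have t: "linear_op t"
    unfolding t_def
    by (intro linear_op_plus linear_op_times linear_op_compose [OF linear_op_times linear_op_sigma, unfolded comp_def])
  note lc = submod_lin_closed(2) [OF assms(2)]
  have lct: "lin_closed {g. t g \<in> M}"
    using lc by (auto simp: lin_closed_def linear_op_add [OF t] linear_op_scale [OF t] linear_op_0 [OF t])
  have "t g \<in> M" if g: "g \<in> wt e (int c - int d)" for g
  proof -
    have "t (monom2 a b) \<in> M" if "coeff g a b \<noteq> 0" for a b
    proof -
      have "sym_op a b c d f \<in> M"
        using that g assms(1-3) sym_op_D2 by (auto simp: wt_def submod_def)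
      then show ?thesis
        by (simp add: sym_op_top [OF assms(4)] lin_closed_scale_iff [OF lc] t_def)
    qed
    then show ?thesis
      using in_lin_closedI [OF lct] by blast
  qed
  then show ?thesis
    by (auto simp: twist_def t_def)
qed

lemma submod_wt: "e \<ge> 1 \<Longrightarrow> submod (D1 e) (wt e i)"
  using lin_closed_wt D1_wt by (auto simp: submod_def lin_closed_def)

lemma submod_D1_D2: "submod (D1 e) M \<Longrightarrow> submod (D2 e) M"
  by (auto simp: submod_def D2_iff)

lemma submod_sign_wt: "e \<ge> 1 \<Longrightarrow> submod (D2 e) (sign_wt e s i)"
  using submod_D1_D2 [OF submod_wt, of e i]
  by (auto simp: submod_def sign_wt_def D2_iff linear_op_add [OF linear_op_sigma]
      linear_op_0 [OF linear_op_sigma] linear_op_scale [OF D1_linear] distrib_left)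

lemma submod_twist:
  assumes "e \<ge> 1"
  shows "submod (D2 e) (twist e \<alpha> \<beta> i)"
proof -
  define t where "t = (\<lambda>f. const \<alpha> * f + const \<beta> * sigma f)"
  have t: "linear_op t"
    unfolding t_def
    by (intro linear_op_plus linear_op_times linear_op_compose [OF linear_op_times linear_op_sigma, unfolded comp_def])
  have twist: "twist e \<alpha> \<beta> i = t ` wt e i"
    by (simp add: twist_def t_def)
  have lc: "lin_closed (wt e i)"
    by (rule lin_closed_wt)
  have "0 \<in> t ` wt e i"
    using lc by (intro image_eqI [of _ _ 0]) (simp_all add: lin_closed_def linear_op_0 [OF t])
  moreover have "t f + t g \<in> t ` wt e i" if "f \<in> wt e i" "g \<in> wt e i" for f g
    using lc that by (intro image_eqI [of _ _ "f + g"]) (simp_all add: lin_closed_def linear_op_add [OF t])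
  moreover have "P (t f) \<in> t ` wt e i" if "f \<in> wt e i" "P \<in> D2 e" for f P
  proof (rule image_eqI)
    show "P f \<in> wt e i"
      using that D1_wt [OF assms] by (simp add: D2_iff)
    show "P (t f) = t (P f)"
      using that D2_linear [OF that(2)]
      by (simp add: t_def D2_iff linear_op_add linear_op_scale)
  qed
  ultimately show ?thesis
    by (auto simp: submod_def twist)
qed

section \<open>Weight spaces as modules over the dihedral invariants\<close>

lemma lin_closed_sign_wt: "e \<ge> 1 \<Longrightarrow> lin_closed (sign_wt e s i)"
  by (rule submod_lin_closed(2) [OF submod_sign_wt])

lemma sigma_mult: "sigma (f * g) = sigma f * sigma g"
proof -
  have "lin_closed {f. sigma (f * g) = sigma f * sigma g}" for g
    by (auto simp: lin_closed_def linear_op_0 [OF linear_op_sigma] linear_op_add [OF linear_op_sigma]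
        linear_op_scale [OF linear_op_sigma] distrib_right mult.assoc)
  moreover have "sigma (monom2 a b * g) = sigma (monom2 a b) * sigma g" for a b
  proof -
    have "(\<lambda>g. sigma (monom2 a b * g)) = (\<lambda>g. monom2 b a * sigma g)"
      using linear_op_compose [OF linear_op_sigma linear_op_times]
        linear_op_compose [OF linear_op_times linear_op_sigma]
      by (intro linear_op_eqI) (auto simp: comp_def monom2_mult)
    then show ?thesis by (auto dest: fun_cong)
  qed
  ultimately show ?thesis
    using in_lin_closedI [of "{f. sigma (f * g) = sigma f * sigma g}" f] by auto
qed

text \<open>
  The formula that defines \<open>M\<^sub>i\<^sup>1\<close> for positive \<open>i\<close>, here for every \<open>i\<close>. The value
  \<open>i = 0\<close> describes the \<open>C\<^sub>e\<close>-invariants as a module over the dihedral invariants.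
\<close>
definition A2_span :: "nat \<Rightarrow> nat \<Rightarrow> poly2 set" where
  "A2_span e i = {a * x1 ^ i + b * x2 ^ (e - i) | a b. a \<in> A2 e \<and> b \<in> A2 e}"

lemma lin_closed_A2: "e \<ge> 1 \<Longrightarrow> lin_closed (A2 e)"
  by (simp add: A2_eq lin_closed_sign_wt)

lemma A2_mult: "e \<ge> 1 \<Longrightarrow> f \<in> A2 e \<Longrightarrow> g \<in> A2 e \<Longrightarrow> f * g \<in> A2 e"
  using wt_mult [of f e 0 g 0] by (auto simp: A2_eq sign_wt_def sigma_mult)

lemma lin_closed_A2_span: assumes "e \<ge> 1" shows "lin_closed (A2_span e i)"
proof -
  note A = lin_closed_A2 [OF assms, unfolded lin_closed_def]
  have "0 \<in> A2_span e i"
    using A by (force simp: A2_span_def)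
  moreover have "f + g \<in> A2_span e i" if "f \<in> A2_span e i" "g \<in> A2_span e i" for f g
  proof -
    from that obtain a b c d where "a \<in> A2 e" "b \<in> A2 e" "c \<in> A2 e" "d \<in> A2 e"
      "f = a * x1 ^ i + b * x2 ^ (e - i)" "g = c * x1 ^ i + d * x2 ^ (e - i)"
      by (auto simp: A2_span_def)
    then have "f + g = (a + c) * x1 ^ i + (b + d) * x2 ^ (e - i)" "a + c \<in> A2 e" "b + d \<in> A2 e"
      using A by (auto simp: algebra_simps)
    then show ?thesis by (auto simp: A2_span_def)
  qed
  moreover have "const c * f \<in> A2_span e i" if "f \<in> A2_span e i" for f c
  proof -
    from that obtain a b where "a \<in> A2 e" "b \<in> A2 e"
      "f = a * x1 ^ i + b * x2 ^ (e - i)"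
      by (auto simp: A2_span_def)
    then have "const c * f = (const c * a) * x1 ^ i + (const c * b) * x2 ^ (e - i)"
      "const c * a \<in> A2 e" "const c * b \<in> A2 e"
      using A by (auto simp: algebra_simps)
    then show ?thesis by (auto simp: A2_span_def)
  qed
  ultimately show ?thesis
    by (auto simp: lin_closed_def)
qed

lemma A2_span_mult:
  assumes "e \<ge> 1" "h \<in> A2 e" "f \<in> A2_span e i"
  shows "h * f \<in> A2_span e i"
proof -
  from assms(3) obtain a b where "a \<in> A2 e" "b \<in> A2 e" "f = a * x1 ^ i + b * x2 ^ (e - i)"
    by (auto simp: A2_span_def)
  then have "h * f = (h * a) * x1 ^ i + (h * b) * x2 ^ (e - i)" "h * a \<in> A2 e" "h * b \<in> A2 e"
    using A2_mult assms by (auto simp: algebra_simps)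
  then show ?thesis by (auto simp: A2_span_def)
qed

text \<open>
  The relations \<open>(x\<^sub>1\<^sup>e + x\<^sub>2\<^sup>e) m = x\<^sub>1\<^sup>e m + x\<^sub>2\<^sup>e m\<close> let one reduce the difference \<open>a - b = i + k e\<close>
  to the cases \<open>k = 0\<close> and \<open>k = -1\<close>, which are multiples of \<open>x\<^sub>1\<^sup>i\<close> and \<open>x\<^sub>2\<^sup>e\<^sup>-\<^sup>i\<close> by a power of
  \<open>x\<^sub>1 x\<^sub>2\<close>. The measure \<open>|2k + 1|\<close> is symmetric about these two cases.
\<close>
lemma monom2_A2_span:
  assumes "e \<ge> 1" "i \<le> e" "int a - int b = int i + k * int e"
  shows "monom2 a b \<in> A2_span e i"
  using assms(3)
proof (induction "nat \<bar>2 * k + 1\<bar>" arbitrary: a b k rule: less_induct)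
  case less
  note lc = lin_closed_A2_span [OF assms(1), of i]
  have diag: "monom2 m m \<in> A2 e" for m
    using assms(1) by (simp add: A2_eq sign_wt_def)
  have s1: "monom2 e 0 + monom2 0 e \<in> A2 e"
    using lin_closed_wt [of e 0] assms(1)
    by (simp add: A2_eq sign_wt_def lin_closed_def linear_op_add [OF linear_op_sigma] add.commute)
  have A0: "0 \<in> A2 e"
    using lin_closed_A2 [OF assms(1)] by (simp add: lin_closed_def)
  have sub: "f - g \<in> A2_span e i" if "f \<in> A2_span e i" "g \<in> A2_span e i" for f g
  proof -
    have "f + const (-1) * g \<in> A2_span e i"
      using lc that unfolding lin_closed_def by blast
    moreover have "const (-1) = (-1 :: poly2)"
      by (simp add: const_def single_uminus)
    ultimately show ?thesis by simp
  qed
  have kpos: "k * int e \<ge> int e" if "k \<ge> 1"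
    using that assms(1) mult_right_mono [of 1 k "int e"] by simp
  have kneg: "k * int e \<le> - 2 * int e" if "k \<le> -2"
    using that assms(1) mult_right_mono [of k "-2" "int e"] by simp
  consider "k = 0" | "k = -1" | "k \<ge> 1" | "k \<le> -2" by linarith
  then show ?case
  proof cases
    case 1
    then have "a = b + i"
      using less.prems by simp
    then have "monom2 a b = monom2 b b * x1 ^ i + 0 * x2 ^ (e - i)"
      by (simp add: x1_power monom2_mult)
    then show ?thesis
      using diag A0 unfolding A2_span_def by blast
  next
    case 2
    then have "b = a + (e - i)"
      using less.prems assms(2) by simp
    then have "monom2 a b = 0 * x1 ^ i + monom2 a a * x2 ^ (e - i)"
      by (simp add: x2_power monom2_mult)
    then show ?thesis
      using diag A0 unfolding A2_span_def by blast
  next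
    case 3
    have ae: "a \<ge> e"
      using less.prems kpos 3 by linarith
    \<comment> \<open>Multiplying the first monomial by \<open>x\<^sub>1\<^sup>e + x\<^sub>2\<^sup>e\<close> gives the goal plus the second one.\<close>
    have m1: "monom2 (a - e) b \<in> A2_span e i"
      by (rule less.hyps [of "k - 1"]) (use 3 ae less.prems in \<open>auto simp: of_nat_diff algebra_simps\<close>)
    have m2: "monom2 (a - e) (b + e) \<in> A2_span e i"
      by (rule less.hyps [of "k - 2"]) (use 3 ae less.prems in \<open>auto simp: of_nat_diff algebra_simps\<close>)
    have "monom2 a b = (monom2 e 0 + monom2 0 e) * monom2 (a - e) b - monom2 (a - e) (b + e)"
      using ae by (simp add: distrib_right monom2_mult add.commute)
    then show ?thesis
      using sub [OF A2_span_mult [OF assms(1) s1 m1] m2] by simp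
  next
    case 4
    have be: "b \<ge> e"
      using less.prems kneg 4 assms(2) by linarith
    \<comment> \<open>The same relation, this time with \<open>x\<^sub>2\<^sup>e m\<close> as the goal.\<close>
    have m1: "monom2 a (b - e) \<in> A2_span e i"
      by (rule less.hyps [of "k + 1"]) (use 4 be less.prems in \<open>auto simp: of_nat_diff algebra_simps\<close>)
    have m2: "monom2 (a + e) (b - e) \<in> A2_span e i"
      by (rule less.hyps [of "k + 2"]) (use 4 be less.prems in \<open>auto simp: of_nat_diff algebra_simps\<close>)
    have "monom2 a b = (monom2 e 0 + monom2 0 e) * monom2 a (b - e) - monom2 (a + e) (b - e)"
      using be by (simp add: distrib_right monom2_mult add.commute)
    then show ?thesis
      using sub [OF A2_span_mult [OF assms(1) s1 m1] m2] by simp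
  qed
qed

lemma wt_subset_A2_span:
  assumes "e \<ge> 1" "i \<le> e"
  shows "wt e (int i) \<subseteq> A2_span e i"
proof
  fix f assume f: "f \<in> wt e (int i)"
  show "f \<in> A2_span e i"
  proof (rule in_lin_closedI [OF lin_closed_A2_span [OF assms(1)]])
    fix a b assume "coeff f a b \<noteq> 0"
    then obtain k where "int a - int b - int i = int e * k"
      using f by (auto simp: wt_def dvd_def)
    then show "monom2 a b \<in> A2_span e i"
      using assms by (intro monom2_A2_span [of _ _ _ _ k]) (simp_all add: algebra_simps)
  qed
qed

text \<open>
  \<open>N\<^sub>i\<close> contains the span over the smaller ring \<open>A\<^sub>2\<close> and lies in the weight space, and these
  two agree. In particular \<open>N\<^sub>i\<close> and \<open>M\<^sub>i\<^sup>1\<close> coincide as sets for \<open>0 < i < e/2\<close>.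
\<close>
lemma N_eq_wt:
  assumes "e \<ge> 1" "i \<le> e"
  shows "N e i = wt e (int i)" and A2_span_eq_wt: "A2_span e i = wt e (int i)"
proof -
  have "N e i \<subseteq> wt e (int i)"
  proof
    fix f assume "f \<in> N e i"
    then obtain a b where f: "f = a * x1 ^ i + b * x2 ^ (e - i)" "a \<in> wt e 0" "b \<in> wt e 0"
      using assms by (auto simp: N_def A1_eq)
    have "x1 ^ i \<in> wt e (int i)" "x2 ^ (e - i) \<in> wt e (int i)"
      using assms(2) by (auto simp: x1_power x2_power of_nat_diff)
    then have "a * x1 ^ i \<in> wt e (int i)" "b * x2 ^ (e - i) \<in> wt e (int i)"
      using wt_mult [OF f(2)] wt_mult [OF f(3)] by force+
    then show "f \<in> wt e (int i)"
      using lin_closed_wt f(1) unfolding lin_closed_def by blast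
  qed
  moreover have "A2 e \<subseteq> A1 e"
    using assms by (auto simp: A1_eq A2_eq sign_wt_def)
  then have "A2_span e i \<subseteq> N e i"
    by (auto simp: A2_span_def N_def)
  ultimately show "N e i = wt e (int i)" "A2_span e i = wt e (int i)"
    using wt_subset_A2_span [OF assms] by auto
qed

lemma M1_eq_wt: "0 < i \<Longrightarrow> i \<le> e \<Longrightarrow> M1 e i = wt e (int i)"
  using A2_span_eq_wt [of e i] by (simp add: M1_def A2_span_def)

lemma M2_eq_wt:
  assumes "0 < i" "i \<le> e"
  shows "M2 e (e - i) = wt e (int i)"
proof -
  have "M2 e (e - i) = M1 e i"
    using assms by (auto simp: M1_def M2_def) (metis add.commute)+
  then show ?thesis
    by (simp add: M1_eq_wt assms)
qed

text \<open>
  An element of \<open>sign_wt e s i\<close> is half its own image under \<open>1 + s\<sigma>\<close>. Applying this projection to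
  the generators of the weight space over \<open>A\<^sub>2\<close> exhibits a single generator \<open>h\<close>, without any
  polynomial division.
\<close>
lemma sign_wt_eq_multiples:
  assumes "e \<ge> 1" "i \<le> e" "s * s = 1"
  assumes h: "h \<in> sign_wt e s (int i)"
  assumes project: "\<And>a b. a \<in> A2 e \<Longrightarrow> b \<in> A2 e \<Longrightarrow>
    \<exists>c\<in>A2 e. a * x1 ^ i + b * x2 ^ (e - i) + const s * sigma (a * x1 ^ i + b * x2 ^ (e - i)) = c * h"
  shows "sign_wt e s (int i) = {a * h | a. a \<in> A2 e}"
proof (intro Set.set_eqI iffI)
  fix f assume f: "f \<in> sign_wt e s (int i)"
  then obtain a b where ab: "a \<in> A2 e" "b \<in> A2 e" "f = a * x1 ^ i + b * x2 ^ (e - i)"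
    using A2_span_eq_wt [OF assms(1,2)] unfolding sign_wt_def A2_span_def by blast
  then obtain c where "c \<in> A2 e" "f + const s * sigma f = c * h"
    using project by blast
  moreover have "const s * sigma f = f"
    using f by (simp add: sign_wt_def assms(3) flip: mult.assoc const_mult)
  moreover have "const (1/2) * (f + f) = f"
    by (rule poly_mapping_eqI) (simp only: lookup_const_mult lookup_add, simp)
  ultimately have "f = (const (1/2) * c) * h" "const (1/2) * c \<in> A2 e"
    using lin_closed_A2 [OF assms(1)] by (auto simp: mult.assoc lin_closed_def)
  then show "f \<in> {a * h | a. a \<in> A2 e}" by blast
next
  fix f assume "f \<in> {a * h | a. a \<in> A2 e}"
  then show "f \<in> sign_wt e s (int i)"
    using h wt_mult [of _ e 0 h "int i"] assms(1)
    by (auto simp: sign_wt_def A2_eq sigma_mult mult_ac)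
qed

lemma const_minus_1: "const (- 1) = - 1"
  by (simp add: const_def single_uminus)

lemma sigma_x: "sigma (x1 ^ i) = x2 ^ i" "sigma (x2 ^ i) = x1 ^ i"
  by (simp_all add: x1_power x2_power)

lemma sigma_A2: "e \<ge> 1 \<Longrightarrow> a \<in> A2 e \<Longrightarrow> sigma a = a"
  by (simp add: A2_eq sign_wt_def)

lemma x_power_wt: "x1 ^ i \<in> wt e (int i)" "int e dvd 2 * int i \<Longrightarrow> x2 ^ i \<in> wt e (int i)"
proof -
  show "x1 ^ i \<in> wt e (int i)" by (simp add: x1_power)
  assume "int e dvd 2 * int i"
  then have "int e dvd - (2 * int i)" by (simp only: dvd_minus_iff)
  then show "x2 ^ i \<in> wt e (int i)" by (simp add: x2_power)
qed

lemma wt_diff: "f \<in> wt e i \<Longrightarrow> g \<in> wt e i \<Longrightarrow> f - g \<in> wt e i"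
  and wt_add: "f \<in> wt e i \<Longrightarrow> g \<in> wt e i \<Longrightarrow> f + g \<in> wt e i"
proof -
  show "f + g \<in> wt e i" if "f \<in> wt e i" "g \<in> wt e i" for f g
    using lin_closed_wt that unfolding lin_closed_def by blast
  moreover have "- g \<in> wt e i" if "g \<in> wt e i" for g
  proof -
    have "const (-1) * g \<in> wt e i"
      using lin_closed_wt that unfolding lin_closed_def by blast
    then show ?thesis by (simp add: const_minus_1)
  qed
  ultimately show "f \<in> wt e i \<Longrightarrow> g \<in> wt e i \<Longrightarrow> f - g \<in> wt e i"
    using diff_conv_add_uminus [of f g] by metis
qed

lemma A2_add: "e \<ge> 1 \<Longrightarrow> f \<in> A2 e \<Longrightarrow> g \<in> A2 e \<Longrightarrow> f + g \<in> A2 e"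
  and A2_diff: "e \<ge> 1 \<Longrightarrow> f \<in> A2 e \<Longrightarrow> g \<in> A2 e \<Longrightarrow> f - g \<in> A2 e"
  by (auto simp: A2_eq sign_wt_def wt_add wt_diff linear_op_add [OF linear_op_sigma]
     linear_op_diff [OF linear_op_sigma])

lemma MI_eq_sign_wt:
  assumes "i \<ge> 1"
  shows "MI (2 * i) i = sign_wt (2 * i) 1 (int i)"
  unfolding MI_def
proof (rule sign_wt_eq_multiples [symmetric])
  show "x1 ^ i + x2 ^ i \<in> sign_wt (2 * i) 1 (int i)"
    by (simp add: sign_wt_def linear_op_add [OF linear_op_sigma] sigma_x wt_add x_power_wt add.commute)
  show "\<exists>c\<in>A2 (2 * i). a * x1 ^ i + b * x2 ^ (2 * i - i) + const 1 * sigma (a * x1 ^ i + b * x2 ^ (2 * i - i)) = c * (x1 ^ i + x2 ^ i)"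
    if "a \<in> A2 (2 * i)" "b \<in> A2 (2 * i)" for a b
    using that assms
    by (intro bexI [of _ "a + b"]) (simp_all add: A2_add linear_op_add [OF linear_op_sigma] sigma_mult sigma_x sigma_A2 [of "2 * i"] algebra_simps)
qed (use assms in auto)

lemma MII_eq_sign_wt:
  assumes "i \<ge> 1"
  shows "MII (2 * i) i = sign_wt (2 * i) (-1) (int i)"
  unfolding MII_def
proof (rule sign_wt_eq_multiples [symmetric])
  show "x1 ^ i - x2 ^ i \<in> sign_wt (2 * i) (-1) (int i)"
    by (simp add: sign_wt_def linear_op_diff [OF linear_op_sigma] sigma_x wt_diff x_power_wt const_minus_1)
  show "\<exists>c\<in>A2 (2 * i). a * x1 ^ i + b * x2 ^ (2 * i - i) + const (-1) * sigma (a * x1 ^ i + b * x2 ^ (2 * i - i)) = c * (x1 ^ i - x2 ^ i)"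
    if "a \<in> A2 (2 * i)" "b \<in> A2 (2 * i)" for a b
    using that assms
    by (intro bexI [of _ "a - b"]) (simp_all add: A2_diff linear_op_add [OF linear_op_sigma] sigma_mult sigma_x sigma_A2 [of "2 * i"] const_minus_1 algebra_simps)
qed (use assms in auto)

lemma Me_eq_sign_wt:
  assumes "e \<ge> 1"
  shows "Me e = sign_wt e (-1) 0"
proof -
  have "sign_wt e (-1) (int 0) = {a * (x1 ^ e - x2 ^ e) | a. a \<in> A2 e}"
  proof (rule sign_wt_eq_multiples)
    show "x1 ^ e - x2 ^ e \<in> sign_wt e (-1) (int 0)"
      by (simp add: sign_wt_def linear_op_diff [OF linear_op_sigma] sigma_x wt_diff const_minus_1)
         (simp add: x1_power x2_power wt_diff)
    show "\<exists>c\<in>A2 e. a * x1 ^ 0 + b * x2 ^ (e - 0) + const (-1) * sigma (a * x1 ^ 0 + b * x2 ^ (e - 0)) = c * (x1 ^ e - x2 ^ e)"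
      if "a \<in> A2 e" "b \<in> A2 e" for a b
    \<comment> \<open>Here \<open>i = 0\<close>, so \<open>f = a + b x\<^sub>2\<^sup>e\<close>, and the antisymmetrisation leaves \<open>b (x\<^sub>2\<^sup>e - x\<^sub>1\<^sup>e)\<close>.\<close>
    proof (intro bexI [of _ "0 - b"])
      show "0 - b \<in> A2 e"
        using lin_closed_A2 assms that by (intro A2_diff) (auto simp: lin_closed_def)
    qed (use that assms in \<open>simp add: linear_op_add [OF linear_op_sigma] sigma_mult sigma_x sigma_A2 [of e] const_minus_1 algebra_simps\<close>)
  qed (use assms in auto)
  then show ?thesis by (simp add: Me_def)
qed

lemma decompose_sigma:
  "f = const (1/2) * (f + sigma f) + const (1/2) * (f - sigma f)"
  by (rule poly_mapping_eqI) (simp only: lookup_const_mult lookup_add lookup_minus, simp add: field_simps)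

lemma sigma_halves:
  assumes "e \<ge> 1" "int e dvd 2 * i" "f \<in> wt e i"
  shows "const (1/2) * (f + sigma f) \<in> sign_wt e 1 i" "const (1/2) * (f - sigma f) \<in> sign_wt e (-1) i"
proof -
  have "wt e (- i) = wt e i"
    using assms(2) by (intro wt_cong) (metis dvd_minus_iff minus_diff_eq mult_2 diff_minus_eq_add)
  then have "sigma f \<in> wt e i"
    using sigma_wt assms(3) by blast
  then have "f + sigma f \<in> sign_wt e 1 i" "f - sigma f \<in> sign_wt e (-1) i"
    using assms(3)
    by (auto simp: sign_wt_def wt_add wt_diff linear_op_add [OF linear_op_sigma]
       linear_op_diff [OF linear_op_sigma] const_minus_1 add.commute)
  then show "const (1/2) * (f + sigma f) \<in> sign_wt e 1 i" "const (1/2) * (f - sigma f) \<in> sign_wt e (-1) i"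
    using lin_closed_sign_wt [OF assms(1)] unfolding lin_closed_def by blast+
qed

lemma direct_sum_sign_wt:
  assumes "e \<ge> 1" "int e dvd 2 * i"
  shows "is_direct_sum (wt e i) (sign_wt e 1 i) (sign_wt e (-1) i)"
  unfolding is_direct_sum_def
proof
  show "wt e i = {u + v | u v. u \<in> sign_wt e 1 i \<and> v \<in> sign_wt e (-1) i}"
  proof
    show "wt e i \<subseteq> {u + v | u v. u \<in> sign_wt e 1 i \<and> v \<in> sign_wt e (-1) i}"
      using sigma_halves [OF assms] decompose_sigma by blast
  qed (auto simp: sign_wt_def wt_add)
  have "f = 0" if "sigma f = f" "sigma f = - f" for f :: poly2
  proof (rule poly_mapping_eqI)
    have "f = - f" using that by simp
    then have "Poly_Mapping.lookup f k = - Poly_Mapping.lookup f k" for k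
      by (metis lookup_uminus)
    then show "Poly_Mapping.lookup f k = Poly_Mapping.lookup 0 k" for k
      by (simp add: equal_neg_zero)
  qed
  then show "sign_wt e 1 i \<inter> sign_wt e (-1) i = {0}"
    using lin_closed_sign_wt [OF assms(1), of _ i]
    by (auto simp: sign_wt_def const_minus_1 lin_closed_def)
qed

section \<open>MLS-restriction\<close>

definition homog :: "int \<Rightarrow> poly2 \<Rightarrow> bool" where
  "homog n f \<longleftrightarrow> (\<forall>a b. coeff f a b \<noteq> 0 \<longrightarrow> int a + int b = n)"

lemma lin_closed_homog: "lin_closed {f. homog n f}"
proof -
  have "coeff f a b \<noteq> 0 \<or> coeff g a b \<noteq> 0" if "coeff (f + g) a b \<noteq> 0" for f g a b
    using that by (auto simp: lookup_add)
  then show ?thesis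
    unfolding lin_closed_def homog_def by (simp, blast)
qed

lemma homog_monom2I: "(c \<noteq> 0 \<Longrightarrow> int a + int b = n) \<Longrightarrow> homog n (const c * monom2 a b)"
  by (auto simp: homog_def coeff_monom2 split: if_splits)

lemma homog_linear_opI:
  assumes "linear_op P" "\<And>a b. int a + int b = n \<Longrightarrow> homog m (P (monom2 a b))" "homog n f"
  shows "homog m (P f)"
proof -
  have "lin_closed {f. homog m (P f)}"
    using lin_closed_homog [of m] assms(1)
    by (auto simp: lin_closed_def linear_op_add linear_op_scale linear_op_0)
  then show ?thesis
    using in_lin_closedI [of "{f. homog m (P f)}" f] assms(2,3) by (auto simp: homog_def [of n])
qed

text \<open>
  The formal grading of operators agrees with the degrees of the polynomials they act on.
\<close>
lemma weyl_part_homog: "weyl_part d P \<Longrightarrow> homog n f \<Longrightarrow> homog (n + d) (P f)"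
proof (induction arbitrary: n f rule: weyl_part.induct)
  case (1 c)
  then show ?case by (simp add: homog_def)
next
  case 2
  then show ?case
    by (rule homog_linear_opI [OF linear_op_times, rotated])
      (simp_all add: homog_def x1_def mult_single coeff_monom2)
next
  case 3
  then show ?case
    by (rule homog_linear_opI [OF linear_op_times, rotated])
      (simp_all add: homog_def x2_def mult_single coeff_monom2)
next
  case 4
  then show ?case
    by (rule homog_linear_opI [OF linear_op_d1, rotated]) (auto simp: d1_monom2 intro!: homog_monom2I)
next
  case 5
  then show ?case
    by (rule homog_linear_opI [OF linear_op_d2, rotated]) (auto simp: d2_monom2 intro!: homog_monom2I)
next
  case (6 d P Q)
  then show ?case
    using lin_closed_homog [of "n + d"] by (simp add: lin_closed_def)
next
  case (7 d P d' Q)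
  then have "homog (n + d' + d) (P (Q f))" by blast
  then show ?case by (simp add: add_ac)
qed

text \<open>
  An operator of negative degree in \<open>D\<^sub>1\<close> keeps the weight and lowers the degree, so it kills the
  monomials of least degree in a weight space.
\<close>
lemma minimal_degree_killed:
  assumes "e \<ge> 1" "P \<in> neg_part (D1 e)" "monom2 p q \<in> wt e i"
    and "\<And>a b. monom2 a b \<in> wt e i \<Longrightarrow> p + q \<le> a + b"
  shows "P (monom2 p q) = 0"
proof -
  from assms(2) obtain n Q where P: "P = (\<lambda>f. \<Sum>d\<in>{1..n}. Q d f)"
    and Q: "\<And>d. d \<in> {1..n} \<Longrightarrow> Q d \<in> D1 e \<and> weyl_part (- int d) (Q d)"
    unfolding neg_part_def by blast
  have "Q d (monom2 p q) = 0" if d: "d \<in> {1..n}" for d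
  proof (rule poly_mapping_eqI, rule ccontr)
    fix k assume k: "Poly_Mapping.lookup (Q d (monom2 p q)) k \<noteq> Poly_Mapping.lookup 0 k"
    obtain a b where ab: "k = (a, b)" by force
    have "Q d (monom2 p q) \<in> wt e i"
      using Q [OF d] D1_wt assms by blast
    then have "monom2 a b \<in> wt e i"
      using k ab by (auto simp: wt_def [of e i] coeff_monom2)
    then have 1: "p + q \<le> a + b" by (rule assms(4))
    have "homog (int p + int q) (monom2 p q)"
      using homog_monom2I [of 1] by simp
    then have "homog (int p + int q - int d) (Q d (monom2 p q))"
      using weyl_part_homog Q [OF d] by force
    then have "int a + int b = int p + int q - int d"
      using k ab by (auto simp: homog_def)
    then show False using 1 d by auto
  qed
  then show ?thesis by (simp add: P)
qed

text \<open>
  The other summands in the definition of \<open>neg_part\<close> are taken to be zero, which is homogeneous of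
  every negative degree.
\<close>
lemma neg_partI:
  assumes "P \<in> D1 e" "weyl_part (- int n) P" "n \<ge> 1"
  shows "P \<in> neg_part (D1 e)"
proof -
  define Q where "Q = (\<lambda>d. if d = n then P else (\<lambda>f. const 0 * f))"
  have zero: "weyl_part (- int d) (\<lambda>f. const 0 * f)" for d
    using weyl_part.intros(7) [OF weyl_part.intros(1) [of 0] weyl_part_power [OF weyl_part.intros(4), of d]]
    by (simp add: comp_def)
  have "Q d \<in> D1 e \<and> weyl_part (- int d) (Q d)" for d
    using assms(1,2) zero [of d] D1_const [of 0 e] by (simp only: Q_def split: if_splits) blast
  moreover have "P = (\<lambda>f. \<Sum>d\<in>{1..n}. Q d f)"
  proof
    fix f
    have "(\<Sum>d\<in>{1..n}. Q d f) = (\<Sum>d\<in>{1..n}. if d = n then P f else 0)"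
      by (rule sum.cong) (auto simp: Q_def)
    then show "P f = (\<Sum>d\<in>{1..n}. Q d f)"
      using assms(3) by simp
  qed
  ultimately show ?thesis
    unfolding neg_part_def by blast
qed

lemma mod_gen_subset:
  assumes "submod D M" "S \<subseteq> M"
  shows "mod_gen D S \<subseteq> M"
proof
  fix f assume "f \<in> mod_gen D S"
  then obtain n P y where f: "f = (\<Sum>j<n. P j (y j))" "\<forall>j<(n::nat). P j \<in> D \<and> y j \<in> S"
    unfolding mod_gen_def by blast
  have "(\<Sum>j<m. P j (y j)) \<in> M" if "m \<le> n" for m
    using that
  proof (induction m)
    case (Suc m)
    then have "m < n" by simp
    then have "P m (y m) \<in> M"
      using assms f(2) unfolding submod_def by blast
    then show ?case
      using Suc assms(1) by (simp add: submod_def)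
  qed (use assms in \<open>simp add: submod_def\<close>)
  then show "f \<in> M" by (simp add: f(1))
qed

text \<open>
  The values at \<open>y\<close> of all operators in \<open>D\<^sub>2\<close> form a submodule containing \<open>y\<close>, so the leading-term
  argument applies to it.
\<close>
lemma twist_subset_mod_gen:
  assumes "e \<ge> 1" "y \<in> S" "top_at y c d"
  shows "twist e (coeff y c d) (coeff y d c) (int c - int d) \<subseteq> mod_gen (D2 e) S"
proof -
  let ?M = "{P y | P. P \<in> D2 e}"
  have "submod (D2 e) ?M"
    unfolding submod_def
  proof (intro conjI ballI)
    show "0 \<in> ?M"
      using D2_const [of 0 e] by force
  next
    fix f g assume "f \<in> ?M" "g \<in> ?M"
    then obtain P Q where "P \<in> D2 e" "Q \<in> D2 e" "f = P y" "g = Q y" by blast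
    then show "f + g \<in> ?M"
      using D2_plus [of P e Q] by (auto intro: exI [of _ "\<lambda>f. P f + Q f"])
  next
    fix P f assume "P \<in> D2 e" "f \<in> ?M"
    then obtain Q where "Q \<in> D2 e" "f = Q y" by blast
    then have "P f = (P \<circ> Q) y" "P \<circ> Q \<in> D2 e"
      using D2_comp \<open>P \<in> D2 e\<close> by auto
    then show "P f \<in> ?M" by blast
  qed
  moreover have "y \<in> ?M"
    using D2_const [of 1 e] by force
  ultimately have "twist e (coeff y c d) (coeff y d c) (int c - int d) \<subseteq> ?M"
    using assms by (intro D2_submod_contains)
  also have "?M \<subseteq> mod_gen (D2 e) S"
  proof
    fix f assume "f \<in> ?M"
    then obtain P where P: "P \<in> D2 e" "f = P y" by blast
    show "f \<in> mod_gen (D2 e) S"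
      unfolding mod_gen_def
      by (rule CollectI, intro exI [of _ 1] exI [of _ "\<lambda>_. P"] exI [of _ "\<lambda>_. y"])
        (use P assms in auto)
  qed
  finally show ?thesis .
qed

lemma twist_1_0: "twist e 1 0 i = wt e i"
  by (simp add: twist_def)

text \<open>
  On the \<open>s\<close>-eigenspace of \<open>\<sigma>\<close> the operator \<open>\<alpha> + \<beta>\<sigma>\<close> is the scalar \<open>\<alpha> + s\<beta>\<close>.
\<close>
lemma sign_wt_subset_twist:
  assumes "\<alpha> + s * \<beta> \<noteq> 0"
  shows "sign_wt e s i \<subseteq> twist e \<alpha> \<beta> i"
proof
  fix f assume f: "f \<in> sign_wt e s i"
  let ?g = "const (inverse (\<alpha> + s * \<beta>)) * f"
  have "?g \<in> wt e i"
    using f lin_closed_wt by (auto simp: sign_wt_def lin_closed_def)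
  moreover have "f = const \<alpha> * ?g + const \<beta> * sigma ?g"
  proof (rule poly_mapping_eqI)
    fix k
    define u where "u = inverse (\<alpha> + s * \<beta>)"
    have "Poly_Mapping.lookup (const \<alpha> * (const u * f) + const \<beta> * sigma (const u * f)) k =
        \<alpha> * (u * Poly_Mapping.lookup f k) + \<beta> * (u * (s * Poly_Mapping.lookup f k))"
      using f by (simp add: sign_wt_def linear_op_scale [OF linear_op_sigma] lookup_add)
    also have "\<dots> = (u * (\<alpha> + s * \<beta>)) * Poly_Mapping.lookup f k"
      by (simp add: algebra_simps)
    finally have "Poly_Mapping.lookup (const \<alpha> * ?g + const \<beta> * sigma ?g) k =
        (u * (\<alpha> + s * \<beta>)) * Poly_Mapping.lookup f k"
      by (simp only: u_def)
    then show "Poly_Mapping.lookup f k = Poly_Mapping.lookup (const \<alpha> * ?g + const \<beta> * sigma ?g) k"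
      using assms by (simp add: u_def)
  qed
  ultimately show "f \<in> twist e \<alpha> \<beta> i"
    unfolding twist_def by blast
qed

lemma twist_subset_sign_wt:
  assumes "e \<ge> 1" "int e dvd 2 * i" "s * s = 1"
  shows "twist e \<alpha> (s * \<alpha>) i \<subseteq> sign_wt e s i"
proof
  fix f assume "f \<in> twist e \<alpha> (s * \<alpha>) i"
  then obtain g where g: "g \<in> wt e i" "f = const \<alpha> * g + const (s * \<alpha>) * sigma g"
    by (auto simp: twist_def)
  have "wt e (- i) = wt e i"
    using wt_cong [of e "i" "- i"] assms(2) by simp
  then have "sigma g \<in> wt e i"
    using sigma_wt g(1) by blast
  then have "f \<in> wt e i"
    using lin_closed_wt [of e i] g by (simp add: lin_closed_def)
  moreover have "sigma f = const s * f"
  proof (rule poly_mapping_eqI)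
    fix k
    have "s * (s * z) = z" for z using assms(3) by (simp flip: mult.assoc)
    then show "Poly_Mapping.lookup (sigma f) k = Poly_Mapping.lookup (const s * f) k"
      by (simp add: g(2) linear_op_scale [OF linear_op_sigma] linear_op_add [OF linear_op_sigma]
          lookup_add distrib_left mult.assoc)
  qed
  ultimately show "f \<in> sign_wt e s i"
    by (simp add: sign_wt_def)
qed

text \<open>
  For \<open>0 < i < e\<close> the lowest monomials of \<open>N\<^sub>i\<close> are \<open>x\<^sub>1\<^sup>i\<close> or \<open>x\<^sub>2\<^sup>e\<^sup>-\<^sup>i\<close>, or both. Either one has distinct
  exponents \<open>c\<close> and \<open>d\<close>, so its coefficient at \<open>(d, c)\<close> is zero and the dihedral-invariant
  operators already produce the whole weight space from it.
\<close>
lemma J_N: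
  assumes "0 < i" "i < e"
  shows "J e (N e i) = wt e (int i)"
proof
  have e: "e \<ge> 1" using assms by simp
  have N: "N e i = wt e (int i)"
    using assms by (intro N_eq_wt) auto
  show "J e (N e i) \<subseteq> wt e (int i)"
    unfolding J_def N by (rule mod_gen_subset [OF submod_D1_D2 [OF submod_wt [OF e]]]) auto
  \<comment> \<open>The exponents of a monomial of least degree in \<open>N\<^sub>i\<close>.\<close>
  define c d where "c = (if 2 * i \<le> e then i else 0)" and "d = (if 2 * i \<le> e then 0 else e - i)"
  have cd: "c \<noteq> d" using assms by (auto simp: c_def d_def)
  have in_wt: "monom2 c d \<in> wt e (int i)"
    using assms by (auto simp: c_def d_def of_nat_diff)
  have min: "c + d \<le> a + b" if "monom2 a b \<in> wt e (int i)" for a b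
  proof -
    obtain k where k: "int a - int b - int i = int e * k"
      using \<open>monom2 a b \<in> wt e (int i)\<close> by (auto simp: dvd_def)
    have "int e * k \<ge> 0 \<or> int e * k \<le> - int e"
      using mult_left_mono [of k "- 1" "int e"] by (cases "k \<ge> 0") auto
    then show ?thesis
      using k assms by (auto simp: c_def d_def)
  qed
  have "twist e (coeff (monom2 c d) c d) (coeff (monom2 c d) d c) (int c - int d) \<subseteq> J e (N e i)"
    unfolding J_def N
    using in_wt minimal_degree_killed [OF e _ in_wt min]
    by (intro twist_subset_mod_gen [OF e]) (auto simp: top_at_def coeff_monom2 split: if_splits)
  moreover have "wt e (int c - int d) = wt e (int i)"
    using in_wt by (intro wt_cong) simp
  ultimately show "wt e (int i) \<subseteq> J e (N e i)"
    using cd by (simp add: coeff_monom2 twist_1_0)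
qed

text \<open>
  Any nonconstant element of \<open>N\<^sub>0\<close> has a leading exponent \<open>(c, d)\<close> of weight \<open>0\<close> and is not killed by
  \<open>\<partial>\<^sub>1\<^sup>c \<partial>\<^sub>2\<^sup>d\<close>, an invariant operator of negative degree. So only the constants are left, and they are
  symmetric; that is why the restriction is smaller than the weight space here.
\<close>
lemma J_N_0:
  assumes e: "e \<ge> 1"
  shows "J e (N e 0) = sign_wt e 1 0"
proof
  have N: "N e 0 = wt e 0"
    using N_eq_wt [OF e, of 0] by simp
  have one: "monom2 0 0 \<in> sign_wt e 1 0"
    by (simp add: sign_wt_def)
  show "J e (N e 0) \<subseteq> sign_wt e 1 0"
    unfolding J_def N
  proof (rule mod_gen_subset [OF submod_sign_wt [OF e]], safe)
    fix f assume f: "f \<in> wt e 0" and killed: "\<forall>P\<in>neg_part (D1 e). P f = 0"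
    show "f \<in> sign_wt e 1 0"
    proof (cases "f = 0")
      case True
      then show ?thesis using lin_closed_sign_wt [OF e] by (simp add: lin_closed_def)
    next
      case False
      then obtain c d where cd: "coeff f c d \<noteq> 0" "top_at f c d"
        by (rule obtain_top)
      have "c + d = 0"
      proof (rule ccontr)
        assume "c + d \<noteq> 0"
        have "int e dvd int c - int d - 0"
          using f cd by (simp add: wt_def)
        then have "int e dvd - (int c - int d)" by (simp only: dvd_minus_iff diff_0_right)
        then have "normal_op 0 0 c d \<in> D1 e"
          by (intro normal_op_D1 [OF e]) simp
        moreover have "weyl_part (- int (c + d)) (normal_op 0 0 c d)"
          using weyl_part_normal_op [of 0 0 c d] by simp
        ultimately have "normal_op 0 0 c d \<in> neg_part (D1 e)"
          using \<open>c + d \<noteq> 0\<close> by (intro neg_partI [of _ _ "c + d"]) (simp_all, linarith)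
        then have "normal_op 0 0 c d f = 0"
          using killed by blast
        then have "coeff (normal_op 0 0 c d f) 0 0 = 0"
          by simp
        then show False
          using cd by (simp add: normal_op_top coeff_monom2)
      qed
      then have "a = 0 \<and> b = 0" if "coeff f a b \<noteq> 0" for a b
        using that cd(2) unfolding top_at_def by (metis add_is_0 le_zero_eq)
      then have "monom2 a b \<in> sign_wt e 1 0" if "coeff f a b \<noteq> 0" for a b
        using one that by blast
      then show ?thesis
        by (rule in_lin_closedI [OF lin_closed_sign_wt [OF e]])
    qed
  qed
  have "\<forall>P\<in>neg_part (D1 e). P (monom2 0 0) = 0"
    by (rule ballI, rule minimal_degree_killed [OF e, of _ _ _ 0]) simp_all
  moreover have "top_at (monom2 0 0) 0 0"
    by (auto simp: top_at_def coeff_monom2 split: if_splits)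
  ultimately have "twist e (coeff (monom2 0 0) 0 0) (coeff (monom2 0 0) 0 0) (int 0 - int 0) \<subseteq> J e (N e 0)"
    unfolding J_def N by (intro twist_subset_mod_gen [OF e]) simp_all
  then show "sign_wt e 1 0 \<subseteq> J e (N e 0)"
    using sign_wt_subset_twist [of 1 1 1 e 0] by (simp add: coeff_monom2)
qed

section \<open>Simple modules\<close>

lemma monom2_neq_0: "c \<noteq> 0 \<Longrightarrow> const c * monom2 a b \<noteq> 0"
proof
  assume c: "c \<noteq> 0" "const c * monom2 a b = 0"
  then have "coeff (const c * monom2 a b) a b = 0" by simp
  then show False using c(1) by (simp add: coeff_monom2)
qed

lemma monom2_combination_neq_0:
  assumes "\<alpha> \<noteq> 0" "c = d \<longrightarrow> \<alpha> + \<beta> \<noteq> 0"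
  shows "const \<alpha> * monom2 c d + const \<beta> * monom2 d c \<noteq> 0"
proof
  assume "const \<alpha> * monom2 c d + const \<beta> * monom2 d c = 0"
  then have "coeff (const \<alpha> * monom2 c d + const \<beta> * monom2 d c) c d = 0"
    by (simp only: lookup_zero)
  then have "\<alpha> + (if c = d then \<beta> else 0) = 0"
    by (cases "c = d") (simp_all add: lookup_add coeff_monom2)
  then show False using assms by (cases "c = d") simp_all
qed

lemma submod_trivial: "submod D M \<Longrightarrow> M \<subseteq> {0} \<Longrightarrow> M = {0}"
  unfolding submod_def by (elim conjE) (auto simp only: subset_singleton_iff)

lemma simple_submod_eq:
  "simple_submod D M \<Longrightarrow> submod D M' \<Longrightarrow> M' \<subseteq> M \<Longrightarrow> M' \<noteq> {0} \<Longrightarrow> M = M'"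
  unfolding simple_submod_def by blast

lemma wt_nonzero: "wt e (int i) \<noteq> {0}"
proof -
  have "monom2 i 0 \<in> wt e (int i)" "monom2 i 0 \<noteq> 0"
    using monom2_neq_0 [of 1 i 0] by simp_all
  then show ?thesis by blast
qed

lemma wt_unique: "f \<in> wt e i \<Longrightarrow> coeff f c d \<noteq> 0 \<Longrightarrow> wt e (int c - int d) = wt e i"
  by (rule wt_cong) (auto simp: wt_def)

lemma simple_wt:
  assumes "e \<ge> 1"
  shows "simple_submod (D1 e) (wt e (int i))"
  unfolding simple_submod_def
proof (intro conjI allI impI)
  fix M assume M: "submod (D1 e) M \<and> M \<subseteq> wt e (int i)"
  show "M = {0} \<or> M = wt e (int i)"
  proof (cases "M \<subseteq> {0}")
    case False
    then obtain f where f: "f \<in> M" "f \<noteq> 0" by blast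
    then obtain c d where "coeff f c d \<noteq> 0" "top_at f c d" using obtain_top by blast
    then show ?thesis
      using D1_submod_contains [OF assms, of M f c d] f wt_unique [of f e "int i" c d] M by auto
  next
    case True
    then have "M = {0}"
      using M by (intro submod_trivial [of "D1 e"]) simp_all
    then show ?thesis ..
  qed
next
  show "submod (D1 e) (wt e (int i))" by (rule submod_wt [OF assms])
  show "wt e (int i) \<noteq> {0}" by (rule wt_nonzero)
qed

lemma simple_D1_submod:
  assumes "e \<ge> 1" "simple_submod (D1 e) M"
  obtains i where "i < e" "M = wt e (int i)"
proof -
  have M: "submod (D1 e) M" "M \<noteq> {0}"
    using assms(2) by (simp_all add: simple_submod_def)
  then have "\<not> M \<subseteq> {0}"
    using submod_trivial by metis
  then obtain f where f: "f \<in> M" "f \<noteq> 0"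
    by blast
  then obtain c d where cd: "coeff f c d \<noteq> 0" "top_at f c d" using obtain_top by blast
  obtain i where i: "i < e" "wt e (int c - int d) = wt e (int i)"
    by (rule wt_nat [OF assms(1)])
  then have "wt e (int i) \<subseteq> M"
    using D1_submod_contains [OF assms(1) M(1) f(1) cd(2,1)] by simp
  then have "M = wt e (int i)"
    using simple_submod_eq [OF assms(2) submod_wt [OF assms(1)]] wt_nonzero by metis
  then show ?thesis using that i by blast
qed

lemma twist_neq_0:
  assumes "\<alpha> \<noteq> 0" "c = d \<longrightarrow> \<alpha> + \<beta> \<noteq> 0"
  shows "twist e \<alpha> \<beta> (int c - int d) \<noteq> {0}"
proof -
  have "const \<alpha> * monom2 c d + const \<beta> * monom2 d c \<in> twist e \<alpha> \<beta> (int c - int d)"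
    unfolding twist_def by (rule image_eqI [where x = "monom2 c d"]) simp_all
  then show ?thesis
    using monom2_combination_neq_0 [OF assms] by blast
qed

text \<open>
  The leading coefficients of any nonzero element force some \<open>(\<alpha> + \<beta>\<sigma>) N\<^sub>i\<close> into the module, which
  simplicity then makes the whole of it.
\<close>
lemma simple_D2_submod:
  assumes "e \<ge> 1" "simple_submod (D2 e) M"
  obtains \<alpha> \<beta> i where "i < e" "\<alpha> \<noteq> 0" "M = twist e \<alpha> \<beta> (int i)"
proof -
  have M: "submod (D2 e) M" "M \<noteq> {0}"
    using assms(2) by (simp_all add: simple_submod_def)
  then have "\<not> M \<subseteq> {0}"
    using submod_trivial by metis
  then obtain f where f: "f \<in> M" "f \<noteq> 0"
    by blast
  then obtain c d where cd: "coeff f c d \<noteq> 0" "top_at f c d" using obtain_top by blast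
  obtain i where i: "i < e" "wt e (int c - int d) = wt e (int i)"
    by (rule wt_nat [OF assms(1)])
  let ?T = "twist e (coeff f c d) (coeff f d c) (int c - int d)"
  have "?T \<subseteq> M"
    using D2_submod_contains [OF assms(1) M(1) f(1) cd(2)] by simp
  moreover have "?T \<noteq> {0}"
    using cd(1) by (intro twist_neq_0) (simp, auto)
  ultimately have "M = ?T"
    using simple_submod_eq [OF assms(2) submod_twist [OF assms(1)]] by metis
  also have "?T = twist e (coeff f c d) (coeff f d c) (int i)"
    using i by (simp add: twist_def)
  finally show ?thesis using that i cd by blast
qed

lemma sign_wt_nonzero:
  assumes "e \<ge> 1" "int e dvd 2 * int i" "s * s = 1"
  shows "sign_wt e s (int i) \<noteq> {0}"
proof -
  \<comment> \<open>The exponents of \<open>x\<^sub>1\<^sup>i\<^sup>+\<^sup>e\<close> are distinct even for \<open>i = 0\<close>, where \<open>1 + s\<sigma>\<close> may kill \<open>x\<^sub>1\<^sup>i\<close>.\<close>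
  have "twist e 1 s (int (i + e) - int 0) \<noteq> {0}"
    using assms(1) by (intro twist_neq_0) auto
  moreover have "twist e 1 s (int (i + e) - int 0) = twist e 1 s (int i)"
    using wt_cong [of e "int (i + e)" "int i"] by (simp add: twist_def)
  moreover have "twist e 1 s (int i) \<subseteq> sign_wt e s (int i)"
    using twist_subset_sign_wt [OF assms, of 1] by simp
  moreover have "0 \<in> twist e 1 s (int i)"
    using submod_twist [OF assms(1)] by (simp add: submod_def)
  ultimately show ?thesis by auto
qed

lemma simple_sign_wt:
  assumes "e \<ge> 1" "int e dvd 2 * int i" "s * s = 1"
  shows "simple_submod (D2 e) (sign_wt e s (int i))"
  unfolding simple_submod_def
proof (intro conjI allI impI)
  fix M assume M: "submod (D2 e) M \<and> M \<subseteq> sign_wt e s (int i)"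
  show "M = {0} \<or> M = sign_wt e s (int i)"
  proof (cases "M \<subseteq> {0}")
    case False
    then obtain f where f: "f \<in> M" "f \<noteq> 0" by blast
    then obtain c d where cd: "coeff f c d \<noteq> 0" "top_at f c d" using obtain_top by blast
    have fs: "f \<in> wt e (int i)" "sigma f = const s * f"
      using f M by (auto simp: sign_wt_def)
    then have "coeff f d c = s * coeff f c d"
      by (metis coeff_sigma lookup_const_mult)
    then have "twist e (coeff f c d) (s * coeff f c d) (int i) \<subseteq> M"
      using D2_submod_contains [OF assms(1), of M f c d] f M cd wt_unique [OF fs(1) cd(1)]
      by (simp add: twist_def)
    moreover have "sign_wt e s (int i) \<subseteq> twist e (coeff f c d) (s * coeff f c d) (int i)"
      using cd assms(3) by (intro sign_wt_subset_twist) (simp flip: mult.assoc)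
    ultimately show ?thesis
      using M by blast
  next
    case True
    then have "M = {0}"
      using M by (intro submod_trivial [of "D2 e"]) simp_all
    then show ?thesis ..
  qed
next
  show "submod (D2 e) (sign_wt e s (int i))" by (rule submod_sign_wt [OF assms(1)])
  show "sign_wt e s (int i) \<noteq> {0}" by (rule sign_wt_nonzero [OF assms])
qed

lemma mod_iso_sym:
  assumes "submod D M" "mod_iso D M M'"
  shows "mod_iso D M' M"
proof -
  obtain \<theta> where \<theta>: "bij_betw \<theta> M M'" "\<And>f g. f \<in> M \<Longrightarrow> g \<in> M \<Longrightarrow> \<theta> (f + g) = \<theta> f + \<theta> g"
    "\<And>P f. P \<in> D \<Longrightarrow> f \<in> M \<Longrightarrow> \<theta> (P f) = P (\<theta> f)"
    using assms(2) unfolding mod_iso_def by blast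
  let ?\<eta> = "inv_into M \<theta>"
  have \<eta>: "?\<eta> f \<in> M" "\<theta> (?\<eta> f) = f" if "f \<in> M'" for f
    using \<theta>(1) that by (auto simp: bij_betw_def inv_into_into f_inv_into_f)
  have \<eta>': "?\<eta> (\<theta> f) = f" if "f \<in> M" for f
    using \<theta>(1) that by (auto simp: bij_betw_def)
  have "?\<eta> (f + g) = ?\<eta> f + ?\<eta> g" if "f \<in> M'" "g \<in> M'" for f g
    using \<eta>' [of "?\<eta> f + ?\<eta> g"] \<eta> that assms(1) \<theta>(2) by (simp add: submod_def)
  moreover have "?\<eta> (P f) = P (?\<eta> f)" if "f \<in> M'" "P \<in> D" for f P
    using \<eta>' [of "P (?\<eta> f)"] \<eta> that assms(1) \<theta>(3) by (simp add: submod_def)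
  ultimately show ?thesis
    unfolding mod_iso_def using bij_betw_inv_into [OF \<theta>(1)] by blast
qed

lemma mod_iso_refl: "mod_iso D M M"
  unfolding mod_iso_def by (rule exI [of _ id]) auto

text \<open>
  If \<open>i\<close> and \<open>-i\<close> are different weights, then \<open>N\<^sub>i\<close> meets \<open>\<sigma>(N\<^sub>i)\<close> trivially, so \<open>\<alpha> + \<beta>\<sigma>\<close> is injective on
  \<open>N\<^sub>i\<close> as soon as \<open>\<alpha> \<noteq> 0\<close>.
\<close>
lemma twist_iso_wt:
  assumes "e \<ge> 1" "\<not> int e dvd 2 * i" "\<alpha> \<noteq> 0"
  shows "mod_iso (D2 e) (wt e i) (twist e \<alpha> \<beta> i)"
  unfolding mod_iso_def
proof (intro exI conjI ballI)
  let ?t = "\<lambda>f. const \<alpha> * f + const \<beta> * sigma f"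
  show "bij_betw ?t (wt e i) (twist e \<alpha> \<beta> i)"
    unfolding bij_betw_def
  proof
    show "inj_on ?t (wt e i)"
    proof (rule inj_onI)
      fix f g assume f: "f \<in> wt e i" and g: "g \<in> wt e i" and eq: "?t f = ?t g"
      define h where "h = f - g"
      have h: "h \<in> wt e i"
        using f g by (simp add: h_def wt_diff)
      have t0: "?t h = 0"
        using eq by (simp add: h_def linear_op_diff [OF linear_op_sigma] algebra_simps)
      have "coeff h a b = 0" for a b
      proof (rule ccontr)
        assume nz: "coeff h a b \<noteq> 0"
        have "coeff h b a = 0"
        proof (rule ccontr)
          assume "coeff h b a \<noteq> 0"
          then have "int e dvd int b - int a - i" "int e dvd int a - int b - i"
            using h nz by (auto simp: wt_def)
          then have "int e dvd (int b - int a - i) + (int a - int b - i)"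
            by (rule dvd_add)
          also have "(int b - int a - i) + (int a - int b - i) = - (2 * i)" by simp
          finally have "int e dvd 2 * i" by (simp only: dvd_minus_iff)
          then show False using assms(2) by simp
        qed
        then have "coeff (?t h) a b = \<alpha> * coeff h a b"
          by (simp add: lookup_add)
        then show False
          using t0 nz assms(3) by simp
      qed
      then have "h = 0"
        by (intro poly_mapping_eqI) auto
      then show "f = g" by (simp add: h_def)
    qed
  qed (simp add: twist_def)
  show "?t (f + g) = ?t f + ?t g" for f g
    by (simp add: linear_op_add [OF linear_op_sigma] algebra_simps)
  show "?t (P f) = P (?t f)" if "P \<in> D2 e" for P f
    using that D2_linear [OF that] by (simp add: D2_iff linear_op_add linear_op_scale)
qed

text \<open>
  When \<open>i\<close> and \<open>-i\<close> are the same weight, at least one of the scalars \<open>\<alpha> + \<beta>\<close> and \<open>\<alpha> - \<beta>\<close> is nonzero, so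
  \<open>(\<alpha> + \<beta>\<sigma>) N\<^sub>i\<close> contains an eigenspace of \<open>\<sigma>\<close>, and simplicity makes it equal to that.
\<close>
lemma simple_D2_cases:
  assumes "e \<ge> 1" "simple_submod (D2 e) M"
  obtains (wt) i where "0 < i" "i < e" "mod_iso (D2 e) M (wt e (int i))"
    | (sign_wt) i s where "i < e" "int e dvd 2 * int i" "s = 1 \<or> s = -1" "M = sign_wt e s (int i)"
proof -
  obtain \<alpha> \<beta> i where M: "i < e" "\<alpha> \<noteq> 0" "M = twist e \<alpha> \<beta> (int i)"
    using simple_D2_submod [OF assms] by blast
  show thesis
  proof (cases "int e dvd 2 * int i")
    case False
    then have "mod_iso (D2 e) M (wt e (int i))"
      using twist_iso_wt [OF assms(1) False M(2)] M submod_D1_D2 [OF submod_wt [OF assms(1)]]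
      by (auto intro: mod_iso_sym)
    moreover have "0 < i" using False by (cases i) auto
    ultimately show thesis using wt M by blast
  next
    case True
    obtain s where s: "s = 1 \<or> s = -1" "\<alpha> + s * \<beta> \<noteq> 0"
    proof (cases "\<alpha> + 1 * \<beta> = 0")
      case True
      then have "\<alpha> + (-1) * \<beta> \<noteq> 0"
        using M(2) by (auto simp: add_eq_0_iff)
      then show thesis using that by blast
    qed (use that in blast)
    then have "sign_wt e s (int i) \<subseteq> M"
      using sign_wt_subset_twist M by blast
    moreover have "s * s = 1" using s by auto
    then have "sign_wt e s (int i) \<noteq> {0}"
      by (rule sign_wt_nonzero [OF assms(1) True])
    ultimately have "M = sign_wt e s (int i)"
      using simple_submod_eq [OF assms(2) submod_sign_wt [OF assms(1)]] by metis
    then show thesis using sign_wt M s True by blast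
  qed
qed

section \<open>Semi-invariants that are not restrictions\<close>

lemma J_image_iff:
  assumes "e \<ge> 1"
  shows "J_image e M \<longleftrightarrow> (\<exists>i<e. mod_iso (D2 e) M (J e (N e i)))"
proof
  assume "J_image e M"
  then obtain N' where N': "simple_submod (D1 e) N'" "mod_iso (D2 e) M (J e N')"
    by (auto simp: J_image_def)
  then obtain i where "i < e" "N' = wt e (int i)"
    using simple_D1_submod [OF assms] by blast
  then have "i < e \<and> mod_iso (D2 e) M (J e (N e i))"
    using N'(2) N_eq_wt [OF assms, of i] by simp
  then show "\<exists>i<e. mod_iso (D2 e) M (J e (N e i))" ..
next
  assume "\<exists>i<e. mod_iso (D2 e) M (J e (N e i))"
  then obtain i where "i < e" "mod_iso (D2 e) M (J e (N e i))" by blast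
  moreover have "simple_submod (D1 e) (N e i)"
    using simple_wt [OF assms, of i] N_eq_wt [OF assms, of i] \<open>i < e\<close> by simp
  ultimately show "J_image e M"
    unfolding J_image_def by blast
qed

text \<open>
  The Euler operator \<open>x\<^sub>1 \<partial>\<^sub>1 + x\<^sub>2 \<partial>\<^sub>2\<close> and the operator \<open>2 x\<^sub>1 x\<^sub>2 \<partial>\<^sub>1 \<partial>\<^sub>2\<close> lie in \<open>D\<^sub>2\<close> and are
  diagonal on monomials. Together they determine the unordered pair of exponents.
\<close>
lemma coeff_sym_op_euler: "coeff (sym_op 1 0 1 0 f) a b = of_nat (a + b) * coeff f a b"
proof -
  have "coeff (sym_op 1 0 1 0 (monom2 c d)) a b = of_nat (c + d) * coeff (monom2 c d) a b" for c d
    by (cases c; cases d) (auto simp: sym_op_def normal_op_monom2 lookup_add coeff_monom2)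
  from coeff_linear_opI [OF linear_op_sym_op, of 1 0 1 0 "(a, b)" "\<lambda>c d. of_nat (c + d)", OF this]
  show ?thesis by simp
qed

lemma coeff_sym_op_mixed: "coeff (sym_op 1 1 1 1 f) a b = 2 * of_nat (a * b) * coeff f a b"
proof -
  have "coeff (sym_op 1 1 1 1 (monom2 c d)) a b = 2 * of_nat (c * d) * coeff (monom2 c d) a b" for c d
    unfolding sym_op_def lookup_add normal_op_monom2 lookup_const_mult
    by (cases c; cases d) (auto simp: coeff_monom2 algebra_simps)
  from coeff_linear_opI [OF linear_op_sym_op, of 1 1 1 1 "(a, b)" "\<lambda>c d. 2 * of_nat (c * d)", OF this]
  show ?thesis by simp
qed

text \<open>
  Injective \<open>D\<^sub>2\<close>-linear maps preserve the eigenvalues of the two diagonal operators. Hence a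
  preimage of a pure power of one variable is a combination of pure powers of the same degree.
\<close>
lemma mod_iso_eigen:
  assumes e: "e \<ge> 1" and M: "submod (D2 e) M"
    and inj: "inj_on \<theta> M" and \<theta>: "\<And>P f. P \<in> D2 e \<Longrightarrow> f \<in> M \<Longrightarrow> \<theta> (P f) = P (\<theta> f)"
    and g: "g \<in> M" and \<theta>g: "\<theta> g = monom2 p q" and pq: "p = 0 \<or> q = 0"
    and ab: "coeff g a b \<noteq> 0"
  shows "a + b = p + q \<and> (a = 0 \<or> b = 0)"
proof -
  have P: "P g = const c * g" if "P \<in> D2 e" "P (monom2 p q) = const c * monom2 p q" for P c
  proof (rule inj_onD [OF inj])
    show "\<theta> (P g) = \<theta> (const c * g)"
      using \<theta> [OF that(1) g] \<theta> [OF D2_const [of c] g] that(2) by (simp add: \<theta>g)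
    show "P g \<in> M" "const c * g \<in> M"
      using that(1) D2_const [of c e] g M unfolding submod_def by blast+
  qed
  have E: "sym_op 1 0 1 0 (monom2 p q) = const (of_nat (p + q)) * monom2 p q"
    by (rule poly_mapping_eqI) (auto simp only: split_paired_all coeff_sym_op_euler lookup_const_mult coeff_monom2, simp)
  have F: "sym_op 1 1 1 1 (monom2 p q) = const 0 * monom2 p q"
    by (rule poly_mapping_eqI)
      (use pq in \<open>auto simp only: split_paired_all coeff_sym_op_mixed lookup_const_mult coeff_monom2, auto\<close>)
  have "coeff (sym_op 1 0 1 0 g) a b = coeff (const (of_nat (p + q)) * g) a b"
    using P [OF sym_op_D2 E] e by simp
  then have 1: "(of_nat (a + b) :: complex) = of_nat (p + q)"
    using ab by (simp only: coeff_sym_op_euler lookup_const_mult) simp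
  have "coeff (sym_op 1 1 1 1 g) a b = coeff (const 0 * g) a b"
    using P [OF sym_op_D2 F] e by simp
  then have 2: "a = 0 \<or> b = 0"
    using ab by (simp only: coeff_sym_op_mixed lookup_const_mult) simp
  from 1 2 show ?thesis by (simp only: of_nat_eq_iff)
qed

lemma dvd_diff_less_eq:
  assumes "int e dvd int j - int i" "i < e" "j < e"
  shows "i = j"
proof -
  have "int j mod int e = int i mod int e"
    using assms(1) by (simp add: mod_eq_dvd_iff)
  then show ?thesis using assms(2,3) by simp
qed

text \<open>
  An isomorphism onto \<open>J(N\<^sub>j)\<close> pulls the pure powers of degree \<open>j\<close> in \<open>J(N\<^sub>j)\<close> back to
  combinations of \<open>x\<^sub>1\<^sup>j\<close> and \<open>x\<^sub>2\<^sup>j\<close>. For \<open>j = 0\<close> the preimage of \<open>1\<close> is a nonzero constant, which forces the trivial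
  character. For \<open>j > 0\<close> the weights force \<open>j = i\<close>; then \<open>J(N\<^sub>j)\<close> contains both \<open>x\<^sub>1\<^sup>j\<close> and \<open>x\<^sub>2\<^sup>j\<close>, while
  the \<open>\<sigma>\<close>-eigenspace contains, among their combinations, only the multiples of \<open>x\<^sub>1\<^sup>j + s x\<^sub>2\<^sup>j\<close>.
\<close>
lemma sign_wt_not_J_image:
  assumes e: "e \<ge> 1" and i: "i < e" "int e dvd 2 * int i" and s: "s * s = 1" "\<not> (i = 0 \<and> s = 1)"
  shows "\<not> J_image e (sign_wt e s (int i))"
proof
  let ?M = "sign_wt e s (int i)"
  assume "J_image e ?M"
  then obtain j where j: "j < e" "mod_iso (D2 e) ?M (J e (N e j))"
    using J_image_iff [OF e] by blast
  obtain \<theta> where \<theta>: "bij_betw \<theta> ?M (J e (N e j))"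
    "\<And>P f. P \<in> D2 e \<Longrightarrow> f \<in> ?M \<Longrightarrow> \<theta> (P f) = P (\<theta> f)"
    using j(2) unfolding mod_iso_def by blast
  have inj: "inj_on \<theta> ?M"
    using \<theta>(1) by (rule bij_betw_imp_inj_on)
  note M = submod_sign_wt [OF e, of s "int i"]
  have preimage: "\<exists>g\<in>?M. \<theta> g = y" if "y \<in> J e (N e j)" for y
    using that bij_betw_imp_surj_on [OF \<theta>(1)] by (metis imageE)
  have nonzero: "g \<noteq> 0" if "g \<in> ?M" "\<theta> g = monom2 p q" for g p q
  proof
    assume "g = 0"
    then have "\<theta> (const 0 * g) = const 0 * \<theta> g"
      using \<theta>(2) [OF D2_const that(1)] by blast
    then have "monom2 p q = 0"
      using that(2) \<open>g = 0\<close> by simp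
    then show False
      using monom2_neq_0 [of 1 p q] by simp
  qed
  have s0: "s \<noteq> 0" using s(1) by auto
  have swap: "coeff g b a = s * coeff g a b" if "g \<in> ?M" for g a b
  proof -
    have "coeff (sigma g) a b = coeff (const s * g) a b"
      using that by (simp add: sign_wt_def)
    then show ?thesis by simp
  qed
  show False
  proof (cases "j = 0")
    case True
    have "monom2 0 0 \<in> J e (N e j)"
      using True by (simp add: J_N_0 [OF e] sign_wt_def)
    then obtain g where g: "g \<in> ?M" "\<theta> g = monom2 0 0"
      using preimage by blast
    obtain a b where ab: "coeff g a b \<noteq> 0"
      using nonzero [OF g] obtain_top by blast
    have "a = 0 \<and> b = 0"
      using mod_iso_eigen [OF e M inj \<theta>(2) g _ ab] by simp
    then have 00: "coeff g 0 0 \<noteq> 0" using ab by simp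
    then have "s = 1"
      using swap [OF g(1), of 0 0] by simp
    moreover have "int e dvd int 0 - int 0 - int i"
      using 00 g(1) unfolding sign_wt_def wt_def by blast
    then have "int e dvd int 0 - int i"
      by (simp only: diff_self of_nat_0)
    then have "i = 0"
      using i(1) j(1) True by (intro dvd_diff_less_eq) auto
    ultimately show False using s(2) by simp
  next
    case False
    then have J: "J e (N e j) = wt e (int j)"
      using j(1) by (intro J_N) auto
    have axis: "coeff g p q \<noteq> 0 \<Longrightarrow> (p = j \<and> q = 0) \<or> (p = 0 \<and> q = j)"
      if "g \<in> ?M" "\<theta> g = monom2 j 0 \<or> \<theta> g = monom2 0 j" for g p q
      using mod_iso_eigen [OF e M inj \<theta>(2) that(1), of j 0 p q]
        mod_iso_eigen [OF e M inj \<theta>(2) that(1), of 0 j p q] that(2) by auto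
    have "monom2 j 0 \<in> J e (N e j)"
      by (simp add: J)
    then obtain g where g: "g \<in> ?M" "\<theta> g = monom2 j 0"
      using preimage by blast
    have line: "f = const (coeff f j 0) * (monom2 j 0 + const s * monom2 0 j)"
      if "f \<in> ?M" "\<theta> f = monom2 j 0 \<or> \<theta> f = monom2 0 j" for f
    proof (rule poly_mapping_eqI)
      fix k :: "nat \<times> nat"
      obtain p q where k: "k = (p, q)" by force
      show "Poly_Mapping.lookup f k = Poly_Mapping.lookup (const (coeff f j 0) * (monom2 j 0 + const s * monom2 0 j)) k"
        using axis [OF that, of p q] swap [OF that(1), of 0 j] False
        by (cases "p = j \<and> q = 0"; cases "p = 0 \<and> q = j")
          (auto simp: k lookup_add coeff_monom2 simp del: One_nat_def)
    qed
    obtain a b where ab: "coeff g a b \<noteq> 0"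
      using nonzero [OF g] obtain_top by blast
    then have gj: "coeff g j 0 \<noteq> 0"
      using axis [OF g(1), of a b] g(2) swap [OF g(1), of j 0] s0 by auto
    then have "int e dvd int j - int 0 - int i"
      using g(1) unfolding sign_wt_def wt_def by blast
    then have "int e dvd int j - int i"
      by simp
    then have "i = j"
      using i(1) j(1) by (rule dvd_diff_less_eq)
    have "int e dvd - (2 * int j)"
      using i(2) \<open>i = j\<close> by (simp only: dvd_minus_iff)
    moreover have "- (2 * int j) = int 0 - int j - int j"
      by simp
    ultimately have "monom2 0 j \<in> J e (N e j)"
      unfolding J monom2_wt by (simp only:)
    then obtain g' where g': "g' \<in> ?M" "\<theta> g' = monom2 0 j"
      using preimage by blast
    obtain c where c: "c = coeff g j 0" "g = const c * (monom2 j 0 + const s * monom2 0 j)"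
      using line [OF g(1)] g(2) by blast
    obtain c' where c': "g' = const c' * (monom2 j 0 + const s * monom2 0 j)"
      using line [OF g'(1)] g'(2) by blast
    \<comment> \<open>The two preimages are proportional, so their images would be too.\<close>
    have "const c' * g = const c * g'"
      unfolding c(2) c' by (rule mult.left_commute)
    then have "\<theta> (const c' * g) = \<theta> (const c * g')"
      by (rule arg_cong)
    then have "const c' * monom2 j 0 = const c * monom2 0 j"
      using \<theta>(2) [OF D2_const g(1), of c'] \<theta>(2) [OF D2_const g'(1), of c] g(2) g'(2) by simp
    then have "coeff (const c' * monom2 j 0) 0 j = coeff (const c * monom2 0 j) 0 j"
      by (simp only:)
    then show False
      using False gj c(1) by (simp add: coeff_monom2)
  qed
qed

text \<open>
  Every element of the dihedral group acts on \<open>sign_wt e s i\<close> by a nonzero scalar, since the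
  generators do. As the space is nonzero, this scalar is unique, hence multiplicative in the group
  element, and it is the required character.
\<close>
lemma sign_wt_semi_invariants:
  assumes e: "e \<ge> 1" and i: "int e dvd 2 * int i" and s: "s * s = 1"
  shows "semi_inv_module e (sign_wt e s (int i))"
proof -
  let ?M = "sign_wt e s (int i)"
  obtain w where w: "w \<in> ?M" "w \<noteq> 0"
    using sign_wt_nonzero [OF assms] lin_closed_sign_wt [OF e] unfolding lin_closed_def by blast
  obtain a b where ab: "coeff w a b \<noteq> 0"
    using w(2) obtain_top by blast
  have unique: "c = d" if "const c * w = const d * w" for c d
  proof -
    have "coeff (const c * w) a b = coeff (const d * w) a b" by (simp only: that)
    then show ?thesis using ab by simp
  qed
  have scalar: "bij g \<and> (linear_op g \<and> (\<exists>c. c \<noteq> 0 \<and> (\<forall>f\<in>?M. g f = const c * f)))" if "g \<in> dih e" for g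
    using that unfolding dih_def
  proof (induction rule: generate_BijGroup_induct)
    case (gen h)
    have "s \<noteq> 0" using s by auto
    have "\<forall>f\<in>?M. rho e f = const (eps e powi int i) * f" "\<forall>f\<in>?M. sigma f = const s * f"
      by (auto simp: sign_wt_def wt_iff_rho [OF e])
    moreover have "eps e powi int i \<noteq> 0" by simp
    ultimately show ?case
      using gen \<open>s \<noteq> 0\<close> linear_op_rho linear_op_sigma by blast
  next
    case (bij h)
    then show ?case using bij_rho bij_sigma by blast
  next
    case id
    have "\<forall>f\<in>?M. id f = const 1 * f" by simp
    moreover have "linear_op id" by (simp add: linear_op_def)
    ultimately show ?case by (metis zero_neq_one)
  next
    case (inv h)
    let ?k = "inv_into UNIV h"
    have hk: "h (?k f) = f" "?k (h f) = f" for f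
      using inv(1) by (simp_all add: bij_is_surj surj_f_inv_f bij_is_inj)
    have lin: "linear_op ?k"
    proof (rule linear_opI)
      show "?k (f + g) = ?k f + ?k g" for f g
        using inv(2) hk by (metis linear_op_add)
      show "?k (const c * f) = const c * ?k f" for c f
        using inv(2) hk by (metis linear_op_scale)
    qed
    obtain c where c: "c \<noteq> 0" "\<forall>f\<in>?M. h f = const c * f" using inv(2) by blast
    have "?k f = const (inverse c) * f" if "f \<in> ?M" for f
    proof -
      have "f = ?k (const c * f)"
        using c(2) that hk(2) by metis
      also have "\<dots> = const c * ?k f"
        by (rule linear_op_scale [OF lin])
      finally have "const (inverse c) * f = const (inverse c) * (const c * ?k f)"
        by (rule arg_cong)
      then show ?thesis
        using c(1) by (simp flip: mult.assoc const_mult)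
    qed
    then show ?case
      using lin c(1) inverse_nonzero_iff_nonzero by blast
  next
    case (comp h k)
    then obtain c d where c: "c \<noteq> 0" "\<forall>f\<in>?M. h f = const c * f" and d: "d \<noteq> 0" "\<forall>f\<in>?M. k f = const d * f"
      by blast
    have "(h \<circ> k) f = const (c * d) * f" if "f \<in> ?M" for f
    proof -
      have "linear_op h" using comp by blast
      then have "(h \<circ> k) f = const d * (const c * f)"
        using c(2) d(2) that by (simp add: linear_op_scale)
      then show ?thesis
        by (simp add: const_mult mult_ac)
    qed
    moreover have "linear_op (h \<circ> k)"
      using comp linear_op_compose by blast
    moreover have "c * d \<noteq> 0" using c d by simp
    ultimately show ?case by blast
  qed
  define \<phi> where "\<phi> = (\<lambda>g. SOME c. c \<noteq> 0 \<and> (\<forall>f\<in>?M. g f = const c * f))"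
  have \<phi>: "\<phi> g \<noteq> 0 \<and> (\<forall>f\<in>?M. g f = const (\<phi> g) * f)" if "g \<in> dih e" for g
    unfolding \<phi>_def by (rule someI_ex) (use scalar [OF that] in blast)
  have \<phi>_eq: "\<phi> g = c" if "g \<in> dih e" "g w = const c * w" for g c
    using \<phi> [OF that(1)] that(2) w(1) by (intro unique) metis
  have gens: "rho e \<in> dih e" "sigma \<in> dih e"
    by (simp_all add: dih_def generate.incl)
  have comp: "g \<circ> h \<in> dih e" if "g \<in> dih e" "h \<in> dih e" for g h
  proof -
    have "g \<otimes>\<^bsub>BijGroup UNIV\<^esub> h = g \<circ> h"
      using scalar [OF that(1)] scalar [OF that(2)]
      by (auto simp: BijGroup_def Bij_def extensional_def restrict_UNIV compose_def)
    then show ?thesis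
      using generate.eng [of g "BijGroup UNIV" _ h] that by (metis dih_def)
  qed
  have "\<phi> (g \<circ> h) = \<phi> g * \<phi> h" if "g \<in> dih e" "h \<in> dih e" for g h
  proof (rule \<phi>_eq [OF comp [OF that]])
    show "(g \<circ> h) w = const (\<phi> g * \<phi> h) * w"
    proof -
      have "linear_op g" using scalar [OF that(1)] by blast
      then have "(g \<circ> h) w = const (\<phi> h) * (const (\<phi> g) * w)"
        using \<phi> [OF that(1)] \<phi> [OF that(2)] w(1) by (simp add: linear_op_scale)
      then show ?thesis
        by (simp add: const_mult mult_ac)
    qed
  qed
  then have "linear_char e \<phi>"
    using \<phi> by (simp add: linear_char_def)
  moreover have "?M = semi_invariants e \<phi>"
  proof
    show "?M \<subseteq> semi_invariants e \<phi>"
      using \<phi> by (auto simp: semi_invariants_def)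
    have "\<phi> (rho e) = eps e powi int i" "\<phi> sigma = s"
      using w(1) wt_iff_rho [OF e] by (auto intro!: \<phi>_eq gens simp: sign_wt_def)
    then show "semi_invariants e \<phi> \<subseteq> ?M"
      using gens by (auto simp: semi_invariants_def sign_wt_def wt_iff_rho [OF e])
  qed
  ultimately show ?thesis
    unfolding semi_inv_module_def by blast
qed

section \<open>The classification\<close>

lemma dvd_2_cases:
  assumes "i < e" "int e dvd 2 * int i"
  shows "i = 0 \<or> e = 2 * i"
proof -
  have "e dvd 2 * i"
    using assms(2) by (metis of_nat_dvd_iff of_nat_mult of_nat_numeral)
  then obtain k where k: "2 * i = e * k" ..
  have "e * k < e * 2" unfolding k [symmetric] using assms(1) by simp
  then have "k < 2" by simp
  then show ?thesis using k by (auto simp: less_2_cases_iff)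
qed

theorem corollary6p8:
  fixes e :: nat
  assumes "e \<ge> 1"
  shows
    "((\<forall>i. 2 * i < e \<longrightarrow> J e (N e i) = M1 e i) \<and>
      (\<forall>i. e < 2 * i \<and> i < e \<longrightarrow> J e (N e i) = M2 e (e - i))) \<and>
     (\<forall>e1. e = 2 * e1 \<longrightarrow> is_direct_sum (J e (N e e1)) (MI e e1) (MII e e1)) \<and>
     ((\<forall>M. simple_submod (D2 e) M \<longrightarrow> J_image e M \<or> semi_inv_module e M) \<and>
      (\<forall>M. (simple_submod (D2 e) M \<and> \<not> J_image e M \<and> semi_inv_module e M) \<longleftrightarrow>
            (M = Me e \<or> (\<exists>e1. e = 2 * e1 \<and> (M = MI e e1 \<or> M = MII e e1)))))"
proof (intro conjI allI impI)
  fix i assume i: "2 * i < e"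
  show "J e (N e i) = M1 e i"
  proof (cases "i = 0")
    case True
    then show ?thesis
      using J_N_0 [OF assms] A2_eq [OF assms] by (simp add: M1_def)
  next
    case False
    then show ?thesis
      using i by (simp add: J_N M1_eq_wt)
  qed
next
  fix i assume "e < 2 * i \<and> i < e"
  then show "J e (N e i) = M2 e (e - i)"
    by (simp add: J_N M2_eq_wt)
next
  fix e1 assume e1: "e = 2 * e1"
  then have "e1 \<ge> 1" using assms by simp
  then show "is_direct_sum (J e (N e e1)) (MI e e1) (MII e e1)"
    using direct_sum_sign_wt [OF assms, of "int e1"] e1
    by (simp add: J_N MI_eq_sign_wt MII_eq_sign_wt)
next
  fix M assume M: "simple_submod (D2 e) M"
  show "J_image e M \<or> semi_inv_module e M"
    using assms M
  proof (cases rule: simple_D2_cases)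
    case (wt i)
    then have "J_image e M"
      using J_N [of i e] by (auto simp: J_image_iff [OF assms])
    then show ?thesis ..
  next
    case (sign_wt i s)
    then have "s * s = 1" by auto
    then show ?thesis
      using sign_wt sign_wt_semi_invariants [OF assms] by blast
  qed
next
  fix M
  let ?list = "M = Me e \<or> (\<exists>e1. e = 2 * e1 \<and> (M = MI e e1 \<or> M = MII e e1))"
  show "(simple_submod (D2 e) M \<and> \<not> J_image e M \<and> semi_inv_module e M) \<longleftrightarrow> ?list"
  proof
    assume M: "simple_submod (D2 e) M \<and> \<not> J_image e M \<and> semi_inv_module e M"
    then have "simple_submod (D2 e) M" by simp
    with assms show ?list
    proof (cases rule: simple_D2_cases)
      case (wt i)
      then have "J_image e M"
        using J_N [of i e] by (auto simp: J_image_iff [OF assms])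
      then show ?thesis using M by simp
    next
      case (sign_wt i s)
      have "\<not> (i = 0 \<and> s = 1)"
      proof
        assume "i = 0 \<and> s = 1"
        then have "M = J e (N e 0)"
          using sign_wt J_N_0 [OF assms] by simp
        then have "J_image e M"
          unfolding J_image_iff [OF assms]
          using assms mod_iso_refl [of "D2 e" M] by (intro exI [of _ 0]) simp
        then show False using M by simp
      qed
      then consider "i = 0" "s = -1" | "e = 2 * i" "i \<ge> 1"
        using dvd_2_cases [OF sign_wt(1,2)] sign_wt(1,3) by (cases "i = 0") auto
      then show ?thesis
      proof cases
        case 1
        then show ?thesis using sign_wt(4) Me_eq_sign_wt [OF assms] by simp
      next
        case 2
        then have "M = MI e i \<or> M = MII e i"
          using sign_wt(3,4) MI_eq_sign_wt [of i] MII_eq_sign_wt [of i] by auto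
        then show ?thesis using 2 by blast
      qed
    qed
  next
    assume ?list
    then obtain i s where *: "i < e" "int e dvd 2 * int i" "s * s = 1" "\<not> (i = 0 \<and> s = 1)"
      "M = sign_wt e s (int i)"
    proof (elim disjE exE conjE)
      assume "M = Me e"
      then show thesis
        using assms by (intro that [of 0 "-1"]) (simp_all add: Me_eq_sign_wt)
    next
      fix e1 assume e1: "e = 2 * e1" "M = MI e e1"
      then show thesis
        using assms by (intro that [of e1 1]) (simp_all add: MI_eq_sign_wt)
    next
      fix e1 assume e1: "e = 2 * e1" "M = MII e e1"
      then show thesis
        using assms by (intro that [of e1 "-1"]) (simp_all add: MII_eq_sign_wt)
    qed
    then show "simple_submod (D2 e) M \<and> \<not> J_image e M \<and> semi_inv_module e M"
      using simple_sign_wt [OF assms *(2,3)] sign_wt_not_J_image [OF assms *(1-4)]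
        sign_wt_semi_invariants [OF assms *(2,3)] by simp
  qed
qed

end
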